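(* Let $n\ge2$, $p>1$, $0<s<1$ and $a=p(1-s)-1$. Let $x_0\in\mathbf{R}^n$, $r>0$, $z_0=(x_0,0)\in\mathbf{R}^{n+1}$, and let $E\subset\overline{B(x_0,r)}\subset\mathbf{R}^n$ be a Borel set. Then $$\operatorname{cap}_{B^s_p}(E,B(x_0,2r))\simeq\operatorname{cap}_{p,|t|^a}\bigl(E\times\{0\},B(z_0,2r)\bigr),$$ where $\operatorname{cap}_{p,|t|^a}$ is the condensor capacity associated with the weight $w(x,t)=|t|^a$ in $\mathbf{R}^n\times\mathbf{R}$.
   Context: Balls are open unless specified otherwise, and the dimension of a ball is determined by its centre: $B(x,r)\subset\mathbf{R}^n$ for $x\in\mathbf{R}^n$ and $B(z,r)\subset\mathbf{R}^{n+1}$ for $z\in\mathbf{R}^{n+1}$. The notation $X\simeq Y$ means $X/C\le Y\le CX$ with a constant $C>0$ independent of $X$ and $Y$; here $C$ is independent of $E$, $x_0$ and $r$ (it may depend on $n$, $p$, $s$). Weighted capacity. Let $d\mu_a=|t|^a\,dx\,dt$ on $\mathbf{R}^{n+1}$. For a ball $B\subset\mathbf{R}^{n+1}$ and a compact set $K\subset B$, $\operatorname{cap}_{p,|t|^a}(K,B)=\inf_v\int_B|\nabla v|^p\,d\mu_a$, the infimum being over all $v\in C_0^\infty(B)$ with $v\ge1$ on $K$. For a Borel set $E\subset B$, $\operatorname{cap}_{p,|t|^a}(E,B)=\sup\{\operatorname{cap}_{p,|t|^a}(K,B):K\subset E\text{ compact}\}$. Besov capacity. For a ball $B\subset\mathbf{R}^n$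 and a compact set $K\subset B$, $\operatorname{cap}_{B^s_p}(K,B)=\inf_v\int_{\mathbf{R}^n}\int_{\mathbf{R}^n}\frac{|v(x)-v(y)|^p}{|x-y|^{n+sp}}\,dx\,dy$, the infimum being over all $v\in C_0^\infty(B)$ with $v\ge1$ on $K$. For a Borel set $E\subset B$, $\operatorname{cap}_{B^s_p}(E,B)=\sup\{\operatorname{cap}_{B^s_p}(K,B):K\subset E\text{ compact}\}$. *)

theory Defs
  imports "HOL-Analysis.Analysis"
begin

(* Continuous differentiability of order k on the whole space, by recursion on the order:
   all directional derivatives of a differentiable function are of order k - 1. *)
primrec C_k :: "nat \<Rightarrow> ('a::euclidean_space \<Rightarrow> real) \<Rightarrow> bool" where
  "C_k 0 v \<longleftrightarrow> continuous_on UNIV v"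
| "C_k (Suc k) v \<longleftrightarrow>
     (\<forall>x. v differentiable (at x)) \<and> (\<forall>h. C_k k (\<lambda>x. frechet_derivative v (at x) h))"

definition C_infinity :: "('a::euclidean_space \<Rightarrow> real) \<Rightarrow> bool" where
  "C_infinity v \<longleftrightarrow> (\<forall>k. C_k k v)"

(* Elements of C_0^infinity(B) are represented by their extension by zero to the whole space. *)
definition test_functions :: "'a::euclidean_space set \<Rightarrow> ('a \<Rightarrow> real) set" where
  "test_functions B = {v. C_infinity v \<and> compact (closure {x. v x \<noteq> 0}) \<and>
                          closure {x. v x \<noteq> 0} \<subseteq> B}"

definition admissible :: "'a::euclidean_space set \<Rightarrow> 'a set \<Rightarrow> ('a \<Rightarrow> real) set" where
  "admissible K B = {v \<in> test_functions B. \<forall>x\<in>K. 1 \<le> v x}"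

definition gradient :: "('a::euclidean_space \<Rightarrow> real) \<Rightarrow> 'a \<Rightarrow> 'a" where
  "gradient v x = (\<Sum>b\<in>Basis. frechet_derivative v (at x) b *\<^sub>R b)"

(* R^{n+1} is 'a \<times> real, whose product norm is the Euclidean one.  At t = 0 the weight is 0
   by the convention 0 powr a = 0, which only concerns a null set. *)
definition weighted_measure :: "real \<Rightarrow> ('a::euclidean_space \<times> real) measure" where
  "weighted_measure a = density lborel (\<lambda>(x, t). ennreal (\<bar>t\<bar> powr a))"

definition weighted_cap_compact ::
    "real \<Rightarrow> real \<Rightarrow> ('a::euclidean_space \<times> real) set \<Rightarrow> ('a \<times> real) set \<Rightarrow> ennreal" where
  "weighted_cap_compact p a K B =
     (INF v\<in>admissible K B. \<integral>\<^sup>+z\<in>B. ennreal (norm (gradient v z) powr p) \<partial>weighted_measure a)"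

definition weighted_cap ::
    "real \<Rightarrow> real \<Rightarrow> ('a::euclidean_space \<times> real) set \<Rightarrow> ('a \<times> real) set \<Rightarrow> ennreal" where
  "weighted_cap p a E B = (SUP K\<in>{K. compact K \<and> K \<subseteq> E}. weighted_cap_compact p a K B)"

(* On the diagonal the integrand is 0 / 0 = 0. *)
definition besov_energy :: "real \<Rightarrow> real \<Rightarrow> ('a::euclidean_space \<Rightarrow> real) \<Rightarrow> ennreal" where
  "besov_energy s p v =
     (\<integral>\<^sup>+y. (\<integral>\<^sup>+x. ennreal (\<bar>v x - v y\<bar> powr p / norm (x - y) powr (real DIM('a) + s * p))
        \<partial>lborel) \<partial>lborel)"

definition besov_cap_compact ::
    "real \<Rightarrow> real \<Rightarrow> 'a::euclidean_space set \<Rightarrow> 'a set \<Rightarrow> ennreal" where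
  "besov_cap_compact s p K B = (INF v\<in>admissible K B. besov_energy s p v)"

definition besov_cap :: "real \<Rightarrow> real \<Rightarrow> 'a::euclidean_space set \<Rightarrow> 'a set \<Rightarrow> ennreal" where
  "besov_cap s p E B = (SUP K\<in>{K. compact K \<and> K \<subseteq> E}. besov_cap_compact s p K B)"

end

theory Submission
  imports Defs
begin

text \<open>Let \<open>n\<close> be the dimension; functions on \<open>\<real>\<^sup>n\<close> occur as the values at \<open>t = 0\<close> of functions of
  \<open>(x, t)\<close>.  Compact subsets of \<open>E \<times> {0}\<close> are exactly the sets
  \<open>K \<times> {0}\<close> with \<open>K \<subseteq> E\<close> compact, so it suffices to compare the capacities of \<open>K\<close> and
  \<open>K \<times> {0}\<close>, and these are infima over test functions.  Each inequality therefore comes from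
  a map between the two classes of admissible functions that controls the energies.

  Trace: a competitor \<open>v\<close> for \<open>K \<times> {0}\<close> restricts to the competitor \<open>x \<mapsto> v (x, 0)\<close> for \<open>K\<close>.
  To bound the Besov energy, join \<open>(x, 0)\<close> and \<open>(y, 0)\<close> by two segments through the point
  \<open>((x + y) / 2, |x - y|)\<close> and integrate the gradient along them.  By symmetry only the first
  segment matters.  Jensen's inequality, Fubini's theorem, a translation in \<open>x\<close> and a dilation in
  \<open>w = y - x\<close> reduce the resulting integral to that of
  \<open>|w| powr (p - n - s p) * (integral of |grad v (x, |w|)| powr p over x)\<close> over \<open>w\<close>, and polar
  coordinates turn the power of \<open>|w|\<close> into the weight \<open>|t| powr a\<close>.  The dilation costs a power
  of the position on the segment; parametrising the segment by \<open>\<theta> ^ m\<close> with \<open>m s \<ge> 1\<close> makes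
  this power bounded (\<open>powr_increment_le\<close>, \<open>cone_energy_le_weighted\<close>).

  Extension: given a competitor \<open>u\<close> for \<open>K\<close>, let \<open>U (x, t)\<close> be the mean of \<open>u\<close> over the ball of
  radius \<open>|t|\<close> about \<open>x\<close>, weighted by a tent.  Written as an integral of \<open>u (x + t y)\<close> over a
  fixed region of \<open>y\<close>, it is as smooth as \<open>u\<close>, also across \<open>t = 0\<close>, and \<open>U (x, 0) = u x\<close>.  Written
  as an integral of \<open>u z\<close> against a kernel that is Lipschitz in \<open>(x, t)\<close>, it has a gradient at
  \<open>(x, t)\<close> bounded by \<open>1 / |t|\<close> times the mean oscillation of \<open>u\<close> about \<open>x\<close> at scale \<open>2 |t|\<close>
  (\<open>gradient_tent_average_le\<close>); integrating in \<open>t\<close> first produces the kernel of the Besov energy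
  (\<open>tent_average_energy_le\<close>).  The product of \<open>U\<close> with a smooth cutoff that is at least 1 on the ball
  of radius \<open>r\<close> and vanishes near the boundary of the ball of radius \<open>2 r\<close> is admissible.  The
  extra term, in which the derivative falls on the cutoff, is absorbed by a Poincare inequality
  for functions that vanish outside a ball (\<open>besov_poincare\<close>); all powers of \<open>r\<close> cancel because
  \<open>a + 1 = p (1 - s)\<close>.\<close>

section \<open>Functions of class C_k and gradients\<close>

lemma C_k_SucI:
  assumes "\<And>x. (v has_derivative v' x) (at x)" "\<And>h. C_k k (\<lambda>x. v' x h)"
  shows "C_k (Suc k) v"
proof -
  have "frechet_derivative v (at x) = v' x" for x
    using frechet_derivative_at[OF assms(1)] by simp
  then show ?thesis
    using assms by (auto simp: differentiable_def)
qed

lemma C_k_Suc_has_derivative: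
  assumes "C_k (Suc k) v"
  shows "(v has_derivative frechet_derivative v (at x)) (at x)"
  using assms frechet_derivative_works by auto

lemma C_k_Suc_imp_C_k: "C_k (Suc k) v \<Longrightarrow> C_k k v"
proof (induction k arbitrary: v)
  case 0
  then show ?case
    by (auto simp: continuous_on_eq_continuous_at intro: differentiable_imp_continuous_within)
next
  case (Suc k)
  then show ?case by (metis C_k.simps(2))
qed

lemma C_k_continuous_on: "C_k k v \<Longrightarrow> continuous_on S v"
proof (induction k)
  case 0
  then show ?case using continuous_on_subset by auto
qed (use C_k_Suc_imp_C_k in blast)

lemma C_k_const [intro]: "C_k k (\<lambda>x. c)"
proof (induction k arbitrary: c)
  case (Suc k)
  show ?case by (rule C_k_SucI[where v' = "\<lambda>_ _. 0"]) (auto intro: Suc)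
qed auto

lemma C_k_linear: "bounded_linear f \<Longrightarrow> C_k k f"
proof (cases k)
  case 0
  assume "bounded_linear f"
  with 0 show ?thesis by (auto intro: linear_continuous_on)
next
  case (Suc j)
  assume "bounded_linear f"
  then have "(f has_derivative f) (at x)" for x
    by (rule bounded_linear_imp_has_derivative)
  then show ?thesis unfolding Suc by (rule C_k_SucI) auto
qed

lemma C_k_add: "C_k k f \<Longrightarrow> C_k k g \<Longrightarrow> C_k k (\<lambda>x. f x + g x)"
proof (induction k arbitrary: f g)
  case 0
  then show ?case by (auto intro: continuous_intros)
next
  case (Suc k)
  show ?case
  proof (rule C_k_SucI)
    show "((\<lambda>x. f x + g x) has_derivative
        (\<lambda>h. frechet_derivative f (at x) h + frechet_derivative g (at x) h)) (at x)" for x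
      by (intro has_derivative_add C_k_Suc_has_derivative[OF Suc.prems(1)]
          C_k_Suc_has_derivative[OF Suc.prems(2)])
  qed (use Suc in auto)
qed

lemma C_k_sum: "finite I \<Longrightarrow> (\<And>i. i \<in> I \<Longrightarrow> C_k k (f i)) \<Longrightarrow> C_k k (\<lambda>x. \<Sum>i\<in>I. f i x)"
  by (induction I rule: finite_induct) (auto intro: C_k_add)

lemma C_k_mult: "C_k k f \<Longrightarrow> C_k k g \<Longrightarrow> C_k k (\<lambda>x. f x * g x)"
proof (induction k arbitrary: f g)
  case 0
  then show ?case by (auto intro: continuous_intros)
next
  case (Suc k)
  show ?case
  proof (rule C_k_SucI)
    show "((\<lambda>x. f x * g x) has_derivative
        (\<lambda>h. f x * frechet_derivative g (at x) h + frechet_derivative f (at x) h * g x)) (at x)" for x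
      by (intro has_derivative_mult C_k_Suc_has_derivative[OF Suc.prems(1)]
          C_k_Suc_has_derivative[OF Suc.prems(2)])
    show "C_k k (\<lambda>x. f x * frechet_derivative g (at x) h + frechet_derivative f (at x) h * g x)" for h
      using Suc.prems C_k_Suc_imp_C_k by (intro C_k_add Suc.IH) auto
  qed
qed

text \<open>The chain rule expresses the derivative of the composition as a sum of products of scalar
  functions, to which the induction hypothesis applies.  Smoothness of the inner map is expressed
  through its components because \<open>C_k\<close> speaks of real-valued functions.\<close>
lemma C_k_compose:
  fixes u :: "'b::euclidean_space \<Rightarrow> real" and G :: "'a::euclidean_space \<Rightarrow> 'b"
  shows "C_k k u \<Longrightarrow> (\<And>b. b \<in> Basis \<Longrightarrow> C_k k (\<lambda>x. G x \<bullet> b)) \<Longrightarrow> C_k k (\<lambda>x. u (G x))"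
proof (induction k arbitrary: u)
  case 0
  have "continuous_on UNIV G"
    using 0(2) by (subst continuous_on_componentwise) auto
  with 0(1) show ?case
    by (auto intro: continuous_on_compose2)
next
  case (Suc k)
  define D where "D x b = frechet_derivative (\<lambda>x. G x \<bullet> b) (at x)" for x b
  have D: "((\<lambda>x. G x \<bullet> b) has_derivative D x b) (at x)" if "b \<in> Basis" for x b
    unfolding D_def using C_k_Suc_has_derivative[OF Suc.prems(2)[OF that]] .
  have G': "(G has_derivative (\<lambda>h. \<Sum>b\<in>Basis. D x b h *\<^sub>R b)) (at x)" for x
    by (subst has_derivative_componentwise_within) (auto simp: inner_sum_left_Basis D)
  have u': "(u has_derivative frechet_derivative u (at y)) (at y)" for y
    using C_k_Suc_has_derivative[OF Suc.prems(1)] .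
  have lin: "linear (frechet_derivative u (at y))" for y
    using u' has_derivative_linear by blast
  show ?case
  proof (rule C_k_SucI)
    show "((\<lambda>x. u (G x)) has_derivative
        (\<lambda>h. \<Sum>b\<in>Basis. D x b h * frechet_derivative u (at (G x)) b)) (at x)" for x
      using has_derivative_compose[OF G' u']
      by (simp add: linear_sum[OF lin] linear_scale[OF lin])
    have G_k: "C_k k (\<lambda>x. G x \<bullet> b)" if "b \<in> Basis" for b
      using Suc.prems(2)[OF that] by (rule C_k_Suc_imp_C_k)
    have "C_k k (\<lambda>x. frechet_derivative u (at (G x)) b)" for b
      using Suc.prems(1) by (intro Suc.IH[where u = "\<lambda>y. frechet_derivative u (at y) b"] G_k) auto
    moreover have "C_k k (\<lambda>x. D x b h)" if "b \<in> Basis" for b h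
      using Suc.prems(2)[OF that] by (auto simp: D_def)
    ultimately show "C_k k (\<lambda>x. \<Sum>b\<in>Basis. D x b h * frechet_derivative u (at (G x)) b)" for h
      by (intro C_k_sum C_k_mult) auto
  qed
qed

text \<open>Differentiation under the integral sign reproduces the form of the integral, with a partial
  derivative of \<open>F\<close> in place of \<open>F\<close>, so induction on \<open>k\<close> applies.\<close>
lemma C_k_integral:
  fixes F :: "'a::euclidean_space \<times> 'b::euclidean_space \<Rightarrow> real"
  assumes \<psi>: "continuous_on UNIV \<psi>"
  shows "C_k k F \<Longrightarrow> C_k k (\<lambda>x. integral (cbox a b) (\<lambda>y. F (x, y) * \<psi> y))"
proof (induction k arbitrary: F)
  case 0
  then have F: "continuous_on UNIV F" by simp
  have "continuous_on (UNIV \<times> cbox a b) (\<lambda>(x, y). F (x, y) * \<psi> y)"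
    unfolding case_prod_beta
    by (intro continuous_intros continuous_on_compose2[OF F] continuous_on_compose2[OF \<psi>]) auto
  then show ?case
    using integral_continuous_on_param[of UNIV a b "\<lambda>x y. F (x, y) * \<psi> y"] by simp
next
  case (Suc k)
  let ?D = "\<lambda>z. frechet_derivative F (at z)"
  have F': "(F has_derivative ?D z) (at z)" for z
    using C_k_Suc_has_derivative[OF Suc.prems] .
  have contF: "continuous_on UNIV F" and contD: "continuous_on UNIV (\<lambda>z. ?D z h)" for h
    using Suc.prems C_k_continuous_on[of "Suc k" F] C_k_continuous_on[of k "\<lambda>z. ?D z h"]
    unfolding C_k.simps(2) by blast+
  define D where "D x y = Blinfun (\<lambda>h. ?D (x, y) (h, 0) * \<psi> y)" for x y
  have D: "blinfun_apply (D x y) h = ?D (x, y) (h, 0) * \<psi> y" for x y h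
  proof -
    have "bounded_linear (\<lambda>h. ?D (x, y) (h, 0))"
      using has_derivative_bounded_linear[OF F'[of "(x, y)"]]
      by (rule bounded_linear_compose)
        (auto intro: bounded_linear_Pair bounded_linear_ident bounded_linear_zero)
    then have "bounded_linear (\<lambda>h. ?D (x, y) (h, 0) * \<psi> y)"
      by (rule bounded_linear_mult_left[THEN bounded_linear_compose])
    then show ?thesis by (simp add: D_def bounded_linear_Blinfun_apply)
  qed
  have dF: "((\<lambda>x. F (x, y) * \<psi> y) has_derivative blinfun_apply (D x y)) (at x)" for x y
  proof -
    have "((\<lambda>x. F (x, y)) has_derivative (\<lambda>h. ?D (x, y) (h, 0))) (at x)"
      by (rule has_derivative_compose[where f = "\<lambda>x. (x, y)" and g = F, OF _ F'])
        (auto intro!: derivative_eq_intros)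
    then have "((\<lambda>x. F (x, y) * \<psi> y) has_derivative (\<lambda>h. ?D (x, y) (h, 0) * \<psi> y)) (at x)"
      by (rule has_derivative_mult_left)
    moreover have "blinfun_apply (D x y) = (\<lambda>h. ?D (x, y) (h, 0) * \<psi> y)"
      by (rule ext) (rule D)
    ultimately show ?thesis by simp
  qed
  have contDb: "continuous_on (UNIV \<times> cbox a b) (\<lambda>(x, y). D x y)"
    unfolding case_prod_beta
    by (rule continuous_on_blinfun_componentwise, unfold D)
      (intro continuous_intros continuous_on_compose2[OF contD] continuous_on_compose2[OF \<psi>], auto)
  have int: "(\<lambda>y. F (x, y) * \<psi> y) integrable_on cbox a b" for x
    by (intro integrable_continuous continuous_intros continuous_on_compose2[OF contF]
        continuous_on_compose2[OF \<psi>]) auto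
  have intD: "D x integrable_on cbox a b" for x
    by (intro integrable_continuous continuous_on_compose2[OF contDb, where f = "\<lambda>y. (x, y)", simplified])
      (auto intro: continuous_intros)
  show ?case
  proof (rule C_k_SucI)
    show "((\<lambda>x. integral (cbox a b) (\<lambda>y. F (x, y) * \<psi> y)) has_derivative
        blinfun_apply (integral (cbox a b) (D x))) (at x)" for x
      using leibniz_rule[of UNIV a b "\<lambda>x y. F (x, y) * \<psi> y" D x] dF int contDb by auto
    have "blinfun_apply (integral (cbox a b) (D x)) h
        = integral (cbox a b) (\<lambda>y. ?D (x, y) (h, 0) * \<psi> y)" for x h
      using blinfun_apply_integral[OF intD] by (simp add: D)
    then show "C_k k (\<lambda>x. blinfun_apply (integral (cbox a b) (D x)) h)" for h
      using Suc.prems Suc.IH[of "\<lambda>z. ?D z (h, 0)"] by auto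
  qed
qed

lemma frechet_derivative_eq_inner_gradient:
  assumes "v differentiable (at x)"
  shows "frechet_derivative v (at x) h = gradient v x \<bullet> h"
proof -
  have lin: "linear (frechet_derivative v (at x))"
    using assms linear_frechet_derivative by blast
  have "frechet_derivative v (at x) (\<Sum>b\<in>Basis. (h \<bullet> b) *\<^sub>R b)
      = (\<Sum>b\<in>Basis. (h \<bullet> b) * frechet_derivative v (at x) b)"
    by (simp add: linear_sum[OF lin] linear_scale[OF lin])
  then show ?thesis
    unfolding euclidean_representation
    by (simp add: gradient_def inner_sum_left inner_commute[of h] mult.commute)
qed

lemma has_derivative_gradient:
  assumes "v differentiable (at x)"
  shows "(v has_derivative (\<lambda>h. gradient v x \<bullet> h)) (at x)"
proof -
  have "frechet_derivative v (at x) = (\<lambda>h. gradient v x \<bullet> h)"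
    by (rule ext) (rule frechet_derivative_eq_inner_gradient[OF assms])
  then show ?thesis using assms frechet_derivative_works by metis
qed

lemma gradient_eqI:
  assumes "(v has_derivative (\<lambda>h. g \<bullet> h)) (at x)"
  shows "gradient v x = g"
proof -
  have "frechet_derivative v (at x) = (\<lambda>h. g \<bullet> h)"
    using frechet_derivative_at[OF assms] by simp
  then show ?thesis by (simp add: gradient_def euclidean_representation)
qed

lemma C_k_1_continuous_gradient:
  assumes "C_k 1 v" shows "continuous_on S (gradient v)"
proof -
  have "continuous_on S (\<lambda>x. frechet_derivative v (at x) b)" for b
    using assms C_k_continuous_on[of 0 "\<lambda>x. frechet_derivative v (at x) b" S] by simp
  then show ?thesis unfolding gradient_def by (intro continuous_intros)
qed

text \<open>Test the derivative in the direction of the gradient.\<close>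
lemma norm_gradient_le:
  assumes "v differentiable (at x)" and "M \<ge> 0"
    and "\<forall>\<^sub>F y in at x. \<bar>v y - v x\<bar> \<le> M * norm (y - x)"
  shows "norm (gradient v x) \<le> M"
proof (rule ccontr)
  let ?g = "gradient v x"
  assume "\<not> ?thesis"
  then have g: "norm ?g > M" and g0: "?g \<noteq> 0" using \<open>M \<ge> 0\<close> by auto
  \<comment> \<open>Half of the excess of the gradient over \<open>M\<close>: a small step in the direction of the
    gradient then violates the Lipschitz bound.\<close>
  define \<epsilon> where "\<epsilon> = (norm ?g - M) / 2"
  have "\<epsilon> > 0" using g by (simp add: \<epsilon>_def)
  obtain d1 where "d1 > 0" and d1: "\<And>y. norm (y - x) < d1 \<Longrightarrow>
      \<bar>v y - v x - ?g \<bullet> (y - x)\<bar> \<le> \<epsilon> * norm (y - x)"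
    using has_derivative_gradient[OF assms(1)] \<open>\<epsilon> > 0\<close>
    unfolding has_derivative_within_alt by force
  obtain d2 where "d2 > 0" and d2: "\<And>y. y \<noteq> x \<Longrightarrow> dist y x < d2 \<Longrightarrow> \<bar>v y - v x\<bar> \<le> M * norm (y - x)"
    using assms(3) unfolding eventually_at by auto
  define d where "d = min d1 d2"
  have "d > 0" using \<open>d1 > 0\<close> \<open>d2 > 0\<close> by (simp add: d_def)
  have d: "\<bar>v y - v x\<bar> \<le> M * norm (y - x) \<and> \<bar>v y - v x - ?g \<bullet> (y - x)\<bar> \<le> \<epsilon> * norm (y - x)"
    if "y \<noteq> x" "dist y x < d" for y
    using d1[of y] d2[of y] that by (simp add: d_def dist_norm)
  define h where "h = (d / (2 * norm ?g)) *\<^sub>R ?g"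
  have h: "norm h = d / 2" "h \<noteq> 0" "?g \<bullet> h = norm ?g * norm h"
    using \<open>d > 0\<close> g0 by (auto simp: h_def dot_square_norm power2_eq_square)
  have "\<bar>v (x + h) - v x\<bar> \<le> M * norm h" "\<bar>v (x + h) - v x - ?g \<bullet> h\<bar> \<le> \<epsilon> * norm h"
    using d[of "x + h"] h \<open>d > 0\<close> by (auto simp: dist_norm)
  then have "norm ?g * norm h \<le> (M + \<epsilon>) * norm h"
    unfolding h(3) distrib_right by linarith
  then show False using h(2) g by (simp add: \<epsilon>_def field_simps)
qed

lemma C_k_1_differentiable: "C_k 1 v \<Longrightarrow> v differentiable (at x)"
  by (simp only: One_nat_def C_k.simps)

lemma gradient_mult:
  assumes "f differentiable (at z)" "g differentiable (at z)"
  shows "gradient (\<lambda>z. f z * g z) z = f z *\<^sub>R gradient g z + g z *\<^sub>R gradient f z"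
proof (rule gradient_eqI)
  have "(\<lambda>h. (f z *\<^sub>R gradient g z + g z *\<^sub>R gradient f z) \<bullet> h)
      = (\<lambda>h. f z * (gradient g z \<bullet> h) + (gradient f z \<bullet> h) * g z)"
    by (simp add: inner_add_left mult.commute)
  then show "((\<lambda>z. f z * g z) has_derivative (\<lambda>h. (f z *\<^sub>R gradient g z + g z *\<^sub>R gradient f z) \<bullet> h)) (at z)"
    using has_derivative_mult[OF has_derivative_gradient[OF assms(1)] has_derivative_gradient[OF assms(2)]]
    by simp
qed

lemma gradient_eq_0_outside_support:
  assumes "z \<notin> closure {x. v x \<noteq> 0}"
  shows "gradient v z = 0"
proof (rule gradient_eqI)
  have "(v has_derivative (\<lambda>_. 0)) (at z)"
  proof (rule has_derivative_transform_within_open)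
    show "((\<lambda>_. 0) has_derivative (\<lambda>_. 0)) (at z)" by simp
    show "open (- closure {x. v x \<noteq> 0})" by (intro open_Compl closed_closure)
    show "z \<in> - closure {x. v x \<noteq> 0}" using assms by simp
    show "0 = v y" if "y \<in> - closure {x. v x \<noteq> 0}" for y
      using that closure_subset[of "{x. v x \<noteq> 0}"] by auto
  qed
  then show "(v has_derivative (\<lambda>h. 0 \<bullet> h)) (at z)" by simp
qed

section \<open>Inequalities and integrals\<close>

lemma powr_add_le:
  fixes \<alpha> \<beta> p :: real
  assumes "\<alpha> \<ge> 0" "\<beta> \<ge> 0" "p > 0"
  shows "(\<alpha> + \<beta>) powr p \<le> 2 powr p * (\<alpha> powr p + \<beta> powr p)"
proof -
  have "(\<alpha> + \<beta>) powr p \<le> (2 * max \<alpha> \<beta>) powr p"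
    using assms by (intro powr_mono2) auto
  also have "\<dots> = 2 powr p * max \<alpha> \<beta> powr p"
    using assms by (subst powr_mult) auto
  also have "max \<alpha> \<beta> powr p \<le> \<alpha> powr p + \<beta> powr p" by (simp add: max_def)
  finally show ?thesis by simp
qed

lemma powr_tangent_line:
  fixes x A p :: real
  assumes "x \<ge> 0" "A \<ge> 0" "p > 1"
  shows "p * A powr (p - 1) * x \<le> x powr p + (p - 1) * A powr p"
proof -
  define q where "q = p / (p - 1)"
  have "x * A powr (p - 1) \<le> x powr p / p + (A powr (p - 1)) powr q / q"
    using assms by (intro Youngs_inequality) (auto simp: q_def field_simps)
  also have "(A powr (p - 1)) powr q = A powr p"
    using assms by (simp add: powr_powr q_def)
  also have "x powr p / p + A powr p / q = (x powr p + (p - 1) * A powr p) / p"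
    using assms by (simp add: q_def field_simps)
  finally show ?thesis using assms by (simp add: field_simps)
qed

text \<open>Jensen's inequality for the convex function \<open>x powr p\<close> and the measure with density \<open>w\<close>,
  obtained by integrating the tangent line at the mean value.  The right-hand side may be infinite.\<close>
lemma jensen_powr:
  fixes f w :: "'a \<Rightarrow> real"
  assumes "p > 1" and f: "\<And>x. f x \<ge> 0" "f \<in> borel_measurable M"
    and w: "\<And>x. w x \<ge> 0" "integrable M w" and fw: "integrable M (\<lambda>x. f x * w x)"
  shows "ennreal ((\<integral>x. f x * w x \<partial>M) powr p)
    \<le> ennreal ((\<integral>x. w x \<partial>M) powr (p - 1)) * (\<integral>\<^sup>+x. ennreal (f x powr p * w x) \<partial>M)"
proof (cases "(\<integral>x. w x \<partial>M) = 0")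
  case True
  then have "AE x in M. w x = 0"
    using integral_nonneg_eq_0_iff_AE[OF w(2)] w(1) by auto
  then have "(\<integral>x. f x * w x \<partial>M) = (\<integral>x. 0 \<partial>M)"
    using fw by (intro integral_cong_AE) auto
  then show ?thesis by simp
next
  case False
  define W where "W = (\<integral>x. w x \<partial>M)"
  \<comment> \<open>The mean value of \<open>f\<close>, at which the tangent line is taken.\<close>
  define A where "A = (\<integral>x. f x * w x \<partial>M) / W"
  define J where "J = (\<integral>\<^sup>+x. ennreal (f x powr p * w x) \<partial>M)"
  have [measurable]: "f \<in> borel_measurable M" "w \<in> borel_measurable M" using f w by auto
  have W: "W > 0"
    using False integral_nonneg_AE[of w M] w(1) by (simp add: W_def less_le)
  have A: "A \<ge> 0" and AW: "(\<integral>x. f x * w x \<partial>M) = A * W"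
    using W f(1) w(1) by (auto simp: A_def intro!: divide_nonneg_pos)
  have cmul: "(\<integral>\<^sup>+x. ennreal (c * h x) \<partial>M) = ennreal (c * (\<integral>x. h x \<partial>M))"
    if "c \<ge> 0" "integrable M h" "\<And>x. h x \<ge> 0" for c h
    using that nn_integral_eq_integral[of M "\<lambda>x. c * h x"] by simp
  have "ennreal (p * A powr (p - 1) * (A * W))
      = (\<integral>\<^sup>+x. ennreal (p * A powr (p - 1) * (f x * w x)) \<partial>M)"
    using assms(1) by (subst cmul[OF _ fw]) (auto simp: AW f w)
  also have "\<dots> \<le> (\<integral>\<^sup>+x. ennreal (f x powr p * w x) + ennreal ((p - 1) * A powr p * w x) \<partial>M)"
  proof (intro nn_integral_mono)
    fix x
    have "p * A powr (p - 1) * f x * w x \<le> (f x powr p + (p - 1) * A powr p) * w x"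
      by (intro mult_right_mono powr_tangent_line f A w assms)
    then show "ennreal (p * A powr (p - 1) * (f x * w x))
        \<le> ennreal (f x powr p * w x) + ennreal ((p - 1) * A powr p * w x)"
      using assms(1) w(1)[of x]
      by (subst ennreal_plus[symmetric], simp, simp, intro ennreal_leI) (simp add: algebra_simps)
  qed
  also have "\<dots> = J + ennreal ((p - 1) * A powr p * W)"
    unfolding J_def W_def using assms(1)
    by (subst nn_integral_add) (auto simp: cmul w)
  also have "p * A powr (p - 1) * (A * W) = A powr p * W + (p - 1) * A powr p * W"
  proof -
    have "A powr (p - 1) * A = A powr p"
      using A by (cases "A = 0") (auto simp: powr_mult_base mult.commute)
    then show ?thesis by (simp add: algebra_simps)
  qed
  also have "ennreal \<dots> = ennreal (A powr p * W) + ennreal ((p - 1) * A powr p * W)"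
    using W assms(1) by (intro ennreal_plus) auto
  finally have "ennreal (A powr p * W) \<le> J"
    by (simp add: ennreal_add_left_cancel_le add.commute)
  then have "ennreal (W powr (p - 1)) * ennreal (A powr p * W) \<le> ennreal (W powr (p - 1)) * J"
    by (intro mult_left_mono) auto
  moreover have "(A * W) powr p = W powr (p - 1) * (A powr p * W)"
    using A W powr_mult_base[of W "p - 1"] by (simp add: powr_mult mult_ac)
  ultimately show ?thesis
    unfolding AW J_def[symmetric] W_def[symmetric] by (simp add: ennreal_mult'[symmetric])
qed

lemma nn_integral_lborel_affine:
  fixes f :: "'a::euclidean_space \<Rightarrow> ennreal"
  assumes [measurable]: "f \<in> borel_measurable borel" and "c \<noteq> 0"
  shows "(\<integral>\<^sup>+x. f x \<partial>lborel) = ennreal (\<bar>c\<bar> ^ DIM('a)) * (\<integral>\<^sup>+x. f (t + c *\<^sub>R x) \<partial>lborel)"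
  by (subst lborel_affine[OF assms(2), of t])
    (simp add: nn_integral_density nn_integral_distr nn_integral_cmult)

lemma nn_integral_lborel_translate:
  fixes f :: "'a::euclidean_space \<Rightarrow> ennreal"
  assumes "f \<in> borel_measurable borel"
  shows "(\<integral>\<^sup>+x. f (t + x) \<partial>lborel) = (\<integral>\<^sup>+x. f x \<partial>lborel)"
  using nn_integral_lborel_affine[OF assms, of 1 t] by simp

text \<open>Both measures give the half-line up to \<open>r\<close> the volume of a ball of radius \<open>r\<close>, and half-lines
  determine a Borel measure.\<close>
lemma distr_norm_lborel:
  "distr lborel borel (norm :: 'a::euclidean_space \<Rightarrow> real)
    = density lborel (\<lambda>h. ennreal (real DIM('a) * unit_ball_vol (real DIM('a)) * h ^ (DIM('a) - 1))
        * indicator {0..} h)"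
    (is "?M = ?N")
proof -
  let ?n = "DIM('a)" and ?\<omega> = "unit_ball_vol (real DIM('a))"
  have M: "emeasure ?M {..r} = ennreal (if r < 0 then 0 else ?\<omega> * r ^ ?n)" for r
  proof -
    have "norm -` {..r} = (cball 0 r :: 'a set)" by auto
    then have "emeasure ?M {..r} = emeasure lborel (cball 0 r :: 'a set)"
      by (subst emeasure_distr) auto
    then show ?thesis by (auto simp: emeasure_cball)
  qed
  have N: "emeasure ?N {..r} = ennreal (if r < 0 then 0 else ?\<omega> * r ^ ?n)" for r
  proof -
    have "emeasure ?N {..r}
        = (\<integral>\<^sup>+h. ennreal (real ?n * ?\<omega> * h ^ (?n - 1)) * indicator {0..r} h \<partial>lborel)"
      by (subst emeasure_density) (auto intro!: nn_integral_cong simp: indicator_def)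
    also have "\<dots> = ennreal (if r < 0 then 0 else ?\<omega> * r ^ ?n)"
    proof (cases "r < 0")
      case False
      have "(\<integral>\<^sup>+h. ennreal (real ?n * ?\<omega> * h ^ (?n - 1)) * indicator {0..r} h \<partial>lborel)
          = ennreal (?\<omega> * r ^ ?n - ?\<omega> * 0 ^ ?n)"
        using False
        by (intro nn_integral_FTC_Icc) (auto intro!: derivative_eq_intros simp: unit_ball_vol_nonneg)
      with False show ?thesis by simp
    qed auto
    finally show ?thesis .
  qed
  show ?thesis
  proof (rule measure_eqI_generator_eq[where E = "range atMost" and \<Omega> = UNIV and A = "\<lambda>i. {..real i}"])
    show "Int_stable (range (atMost :: real \<Rightarrow> _))"
      by (auto simp: Int_stable_def intro!: range_eqI[where x = "min _ _"])
    show "(\<Union>i. {..real i}) = UNIV" using real_arch_simple by auto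
    show "sets ?M = sigma_sets UNIV (range atMost)" "sets ?N = sigma_sets UNIV (range atMost)"
      by (simp_all add: borel_eq_atMost)
    show "emeasure ?M X = emeasure ?N X" if "X \<in> range atMost" for X
      using that M N by auto
    show "emeasure ?M {..real i} \<noteq> \<infinity>" for i unfolding M by simp
  qed auto
qed

lemma nn_integral_norm_polar:
  fixes g :: "real \<Rightarrow> ennreal"
  assumes [measurable]: "g \<in> borel_measurable borel"
  shows "(\<integral>\<^sup>+w. g (norm (w :: 'a::euclidean_space)) \<partial>lborel)
    = ennreal (real DIM('a) * unit_ball_vol (real DIM('a)))
      * (\<integral>\<^sup>+h\<in>{0..}. ennreal (h ^ (DIM('a) - 1)) * g h \<partial>lborel)"
proof -
  let ?c = "real DIM('a) * unit_ball_vol (real DIM('a))"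
  have "(\<integral>\<^sup>+w. g (norm (w :: 'a)) \<partial>lborel) = integral\<^sup>N (distr lborel borel (norm :: 'a \<Rightarrow> real)) g"
    by (simp add: nn_integral_distr)
  also have "\<dots> = (\<integral>\<^sup>+h. ennreal ?c * ((ennreal (h ^ (DIM('a) - 1)) * g h) * indicator {0..} h) \<partial>lborel)"
    unfolding distr_norm_lborel
    by (subst nn_integral_density)
      (auto intro!: nn_integral_cong simp: indicator_def ennreal_mult' mult_ac unit_ball_vol_nonneg)
  finally show ?thesis by (simp add: nn_integral_cmult)
qed

lemma nn_integral_weighted_measure:
  fixes f :: "'a::euclidean_space \<times> real \<Rightarrow> ennreal"
  assumes [measurable]: "f \<in> borel_measurable borel"
  shows "(\<integral>\<^sup>+z. f z \<partial>weighted_measure a)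
    = (\<integral>\<^sup>+t. (\<integral>\<^sup>+x. ennreal (\<bar>t\<bar> powr a) * f (x, t) \<partial>lborel) \<partial>lborel)"
proof -
  have [measurable]: "f \<in> borel_measurable (lborel \<Otimes>\<^sub>M lborel)"
    by (simp add: lborel_prod)
  have "(\<integral>\<^sup>+z. f z \<partial>weighted_measure a)
      = (\<integral>\<^sup>+z. (case z of (x, t) \<Rightarrow> ennreal (\<bar>t\<bar> powr a)) * f z \<partial>(lborel \<Otimes>\<^sub>M lborel))"
    unfolding weighted_measure_def lborel_prod[symmetric]
    by (subst nn_integral_density) auto
  also have "\<dots> = (\<integral>\<^sup>+t. (\<integral>\<^sup>+x. (case (x, t) of (x, t) \<Rightarrow> ennreal (\<bar>t\<bar> powr a)) * f (x, t)
      \<partial>lborel) \<partial>lborel)"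
    by (rule lborel_pair.nn_integral_snd[symmetric]) measurable
  finally show ?thesis by simp
qed

lemma lborel_integral_affine:
  fixes f :: "'a::euclidean_space \<Rightarrow> real"
  assumes [measurable]: "f \<in> borel_measurable borel" and "c \<noteq> 0"
  shows "(\<integral>x. f x \<partial>lborel) = \<bar>c\<bar> ^ DIM('a) * (\<integral>x. f (t + c *\<^sub>R x) \<partial>lborel)"
  by (subst lborel_affine[OF assms(2), of t]) (simp add: integral_density integral_distr)

lemma integrable_continuous_compact_support:
  fixes f :: "'a::euclidean_space \<Rightarrow> real"
  assumes "compact S" and "continuous_on UNIV f" and "\<And>x. x \<notin> S \<Longrightarrow> f x = 0"
  shows "integrable lborel f"
proof -
  have "(\<lambda>x. indicator S x *\<^sub>R f x) = f"
    by (rule ext) (use assms(3) in \<open>auto simp: indicator_def\<close>)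
  then show ?thesis
    using borel_integrable_compact[OF assms(1) continuous_on_subset[OF assms(2)]] by simp
qed

lemma nn_integral_abs_real:
  fixes g :: "real \<Rightarrow> ennreal"
  assumes "g \<in> borel_measurable borel"
  shows "(\<integral>\<^sup>+t. g \<bar>t\<bar> \<partial>lborel) = 2 * (\<integral>\<^sup>+h\<in>{0..}. g h \<partial>lborel)"
  using nn_integral_norm_polar[OF assms, where 'a = real] by simp

lemma nn_integral_powr_tail:
  assumes "\<rho> > 0" "e > 0"
  shows "(\<integral>\<^sup>+h\<in>{\<rho>..}. ennreal (h powr (- 1 - e)) \<partial>lborel) = ennreal (\<rho> powr (- e) / e)"
proof -
  have "(\<integral>\<^sup>+h\<in>{\<rho>..}. ennreal (h powr (- 1 - e)) \<partial>lborel) = ennreal (0 - (- (\<rho> powr (- e) / e)))"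
  proof (rule nn_integral_FTC_atLeast)
    show "((\<lambda>h. - (h powr (- e) / e)) has_real_derivative h powr (- 1 - e)) (at h)" if "\<rho> \<le> h" for h
    proof -
      have "((\<lambda>h. - (h powr (- e) / e)) has_real_derivative h powr (- e - 1)) (at h)"
        using assms that by (auto intro!: derivative_eq_intros)
      moreover have "- e - 1 = - 1 - e" by simp
      ultimately show ?thesis by (simp only:)
    qed
    have "((\<lambda>h. h powr (- e)) \<longlongrightarrow> 0) at_top"
      using assms by (intro tendsto_neg_powr filterlim_ident) auto
    from tendsto_minus[OF tendsto_divide[OF this tendsto_const[of e]]]
    show "((\<lambda>h. - (h powr (- e) / e)) \<longlongrightarrow> 0) at_top"
      using assms by simp
  qed auto
  then show ?thesis by simp
qed

lemma nn_integral_powr_abs_interval: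
  assumes "a > - 1" "c \<ge> 0"
  shows "(\<integral>\<^sup>+t. ennreal (\<bar>t\<bar> powr a) * indicator {..c} \<bar>t\<bar> \<partial>lborel) = ennreal (2 * c powr (a + 1) / (a + 1))"
proof -
  have "(\<integral>\<^sup>+t. ennreal (\<bar>t\<bar> powr a) * indicator {..c} \<bar>t\<bar> \<partial>lborel)
      = 2 * (\<integral>\<^sup>+h\<in>{0..}. ennreal (h powr a) * indicator {..c} h \<partial>lborel)"
    by (rule nn_integral_abs_real) measurable
  also have "(\<integral>\<^sup>+h\<in>{0..}. ennreal (h powr a) * indicator {..c} h \<partial>lborel)
      = (\<integral>\<^sup>+h\<in>{0..c}. ennreal (h powr a) \<partial>lborel)"
    by (intro nn_integral_cong) (auto simp: indicator_def)
  also have "\<dots> = ennreal (c powr (a + 1) / (a + 1))"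
    by (rule nn_integral_has_integral_lebesgue'[OF _ has_integral_powr_from_0[OF assms]]) simp
  also have "2 * \<dots> = ennreal (2 * (c powr (a + 1) / (a + 1)))"
    by (subst ennreal_mult') simp_all
  finally show ?thesis by simp
qed

section \<open>The trace inequality\<close>

text \<open>The segment from \<open>P\<close> to \<open>P + d\<close> is run through as \<open>P + \<theta> ^ m d\<close>.  A large \<open>m\<close> makes the motion slow
  near \<open>P\<close>, which gives a small factor \<open>\<theta> ^ (m - 1)\<close> where it will be needed, while Jensen's
  inequality can still be applied with the uniform weight on the unit interval.\<close>
lemma powr_increment_le:
  fixes v :: "'a::euclidean_space \<Rightarrow> real"
  assumes v: "C_k 1 v" and "p > 1" and "m \<ge> 1"
  shows "ennreal (\<bar>v (P + d) - v P\<bar> powr p) \<le> ennreal ((real m * norm d) powr p) *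
    (\<integral>\<^sup>+\<theta>\<in>{0..1}. ennreal ((\<bar>\<theta>\<bar> ^ (m - 1)) powr p * norm (gradient v (P + \<theta> ^ m *\<^sub>R d)) powr p) \<partial>lborel)"
proof -
  define \<gamma> where "\<gamma> \<theta> = P + \<theta> ^ m *\<^sub>R d" for \<theta> :: real
  define f where "f \<theta> = \<bar>\<theta>\<bar> ^ (m - 1) * norm (gradient v (\<gamma> \<theta>))" for \<theta>
  define f' where "f' \<theta> = gradient v (\<gamma> \<theta>) \<bullet> ((real m * \<theta> ^ (m - 1)) *\<^sub>R d)" for \<theta>
  have cont_\<gamma>: "continuous_on S \<gamma>" for S
    unfolding \<gamma>_def by (intro continuous_intros)
  have cont_g: "continuous_on S (\<lambda>\<theta>. gradient v (\<gamma> \<theta>))" for S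
    by (rule continuous_on_compose2[OF C_k_1_continuous_gradient[OF v, of UNIV] cont_\<gamma>]) auto
  have cont_f: "continuous_on S f" and cont_f': "continuous_on S f'" for S
    unfolding f_def f'_def by (intro continuous_intros cont_g)+
  have diff: "v differentiable (at x)" for x using v by simp
  have f_int: "integrable lborel (\<lambda>\<theta>. f \<theta> * indicator {0..1} \<theta>)"
    using borel_integrable_compact[of "{0..1}" f] cont_f by (simp add: mult.commute)
  have "(f' has_integral (v (\<gamma> 1) - v (\<gamma> 0))) {0..1}"
  proof (rule fundamental_theorem_of_calculus)
    fix \<theta> :: real
    have "(\<gamma> has_derivative (\<lambda>t. t *\<^sub>R ((real m * \<theta> ^ (m - 1)) *\<^sub>R d))) (at \<theta>)"
      unfolding \<gamma>_def by (auto intro!: derivative_eq_intros simp: mult_ac)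
    from has_derivative_compose[OF this has_derivative_gradient[OF diff]]
    show "((\<lambda>\<theta>. v (\<gamma> \<theta>)) has_vector_derivative f' \<theta>) (at \<theta> within {0..1})"
      by (auto simp: has_vector_derivative_def f'_def mult.assoc intro: has_derivative_at_withinI)
  qed simp
  then have "\<bar>v (\<gamma> 1) - v (\<gamma> 0)\<bar> = norm (integral {0..1} f')"
    by (auto simp: integral_unique)
  also have "\<dots> \<le> integral {0..1} (\<lambda>\<theta>. real m * norm d * f \<theta>)"
  proof (rule integral_norm_bound_integral)
    fix \<theta> :: real assume "\<theta> \<in> {0..1}"
    have "norm (f' \<theta>) \<le> norm (gradient v (\<gamma> \<theta>)) * norm ((real m * \<theta> ^ (m - 1)) *\<^sub>R d)"
      unfolding f'_def real_norm_def by (rule Cauchy_Schwarz_ineq2)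
    then show "norm (f' \<theta>) \<le> real m * norm d * f \<theta>"
      by (simp add: f_def abs_mult power_abs mult_ac)
  qed (intro integrable_continuous_interval continuous_intros cont_f cont_f')+
  also have "\<dots> = real m * norm d * (\<integral>\<theta>. f \<theta> * indicator {0..1} \<theta> \<partial>lborel)"
  proof -
    have "integral {0..1} f = (\<integral>\<theta>. f \<theta> * indicator {0..1} \<theta> \<partial>lborel)"
      using set_borel_integral_eq_integral(2)[of "{0..1}" f] f_int
      by (simp add: set_integrable_def set_lebesgue_integral_def mult.commute)
    then show ?thesis by simp
  qed
  finally have le: "\<bar>v (P + d) - v P\<bar> \<le> real m * norm d * (\<integral>\<theta>. f \<theta> * indicator {0..1} \<theta> \<partial>lborel)"
    using assms(3) by (simp add: \<gamma>_def zero_power)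
  have f0: "f \<theta> \<ge> 0" for \<theta> by (simp add: f_def)
  have [measurable]: "f \<in> borel_measurable borel"
    by (rule borel_measurable_continuous_onI[OF cont_f])
  have "\<bar>v (P + d) - v P\<bar> powr p \<le> (real m * norm d * (\<integral>\<theta>. f \<theta> * indicator {0..1} \<theta> \<partial>lborel)) powr p"
    using assms(2) le by (intro powr_mono2) auto
  also have "\<dots> = (real m * norm d) powr p * (\<integral>\<theta>. f \<theta> * indicator {0..1} \<theta> \<partial>lborel) powr p"
    using f0 by (subst powr_mult) (auto intro!: integral_nonneg_AE)
  finally have "ennreal (\<bar>v (P + d) - v P\<bar> powr p)
      \<le> ennreal ((real m * norm d) powr p) * ennreal ((\<integral>\<theta>. f \<theta> * indicator {0..1} \<theta> \<partial>lborel) powr p)"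
    by (simp add: ennreal_mult'[symmetric] ennreal_leI)
  also have "\<dots> \<le> ennreal ((real m * norm d) powr p) *
      (\<integral>\<^sup>+\<theta>. ennreal (f \<theta> powr p * indicator {0..1} \<theta>) \<partial>lborel)"
    using jensen_powr[of p f lborel "indicator {0..1}"] assms(2) f0 f_int
    by (intro mult_left_mono) auto
  also have "(\<integral>\<^sup>+\<theta>. ennreal (f \<theta> powr p * indicator {0..1} \<theta>) \<partial>lborel) =
      (\<integral>\<^sup>+\<theta>\<in>{0..1}. ennreal ((\<bar>\<theta>\<bar> ^ (m - 1)) powr p * norm (gradient v (P + \<theta> ^ m *\<^sub>R d)) powr p) \<partial>lborel)"
    by (auto intro!: nn_integral_cong simp: f_def \<gamma>_def indicator_def powr_mult)
  finally show ?thesis .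
qed

text \<open>The part of the energy of the trace that comes from the segment between \<open>(x, 0)\<close> and the point at
  height \<open>|w|\<close> above the midpoint of \<open>x\<close> and \<open>x + w\<close>.\<close>
definition cone_energy :: "real \<Rightarrow> real \<Rightarrow> ('a::euclidean_space \<times> real \<Rightarrow> real) \<Rightarrow> ennreal" where
  "cone_energy s p v = (\<integral>\<^sup>+x. (\<integral>\<^sup>+w.
     ennreal (\<bar>v (x, 0) - v (x + (1/2) *\<^sub>R w, norm w)\<bar> powr p / norm w powr (real DIM('a) + s * p))
     \<partial>lborel) \<partial>lborel)"

text \<open>The point above the midpoint of \<open>x\<close> and \<open>y\<close> at height \<open>|x - y|\<close> is symmetric in \<open>x\<close> and \<open>y\<close>, so both
  increments towards it contribute the same integral.\<close>
lemma besov_energy_le_cone_energy: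
  fixes v :: "'a::euclidean_space \<times> real \<Rightarrow> real"
  assumes v: "continuous_on UNIV v" and "p > 0"
  shows "besov_energy s p (\<lambda>x. v (x, 0)) \<le> ennreal (2 powr p * 2) * cone_energy s p v"
proof -
  have [measurable]: "v \<in> borel_measurable borel"
    using v by (rule borel_measurable_continuous_onI)
  let ?e = "real DIM('a) + s * p"
  define A where "A x y = ennreal (\<bar>v (x, 0) - v ((1/2) *\<^sub>R (x + y), norm (x - y))\<bar> powr p / norm (x - y) powr ?e)"
    for x y
  have [measurable]: "(\<lambda>z. A (fst z) (snd z)) \<in> borel_measurable (borel \<Otimes>\<^sub>M borel)"
    unfolding A_def by measurable
  have A_meas [measurable]: "case_prod A \<in> borel_measurable (lborel \<Otimes>\<^sub>M lborel)"
    "\<And>x. A x \<in> borel_measurable borel" "\<And>y. (\<lambda>x. A x y) \<in> borel_measurable borel"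
    unfolding A_def by measurable
  have cone: "(\<integral>\<^sup>+x. (\<integral>\<^sup>+y. A x y \<partial>lborel) \<partial>lborel) = cone_energy s p v"
    unfolding cone_energy_def
  proof (rule nn_integral_cong)
    fix x :: 'a
    have "(\<integral>\<^sup>+y. A x y \<partial>lborel) = (\<integral>\<^sup>+w. A x (x + w) \<partial>lborel)"
      by (rule nn_integral_lborel_translate[symmetric]) simp
    also have "\<dots> = (\<integral>\<^sup>+w. ennreal (\<bar>v (x, 0) - v (x + (1/2) *\<^sub>R w, norm w)\<bar> powr p / norm w powr ?e) \<partial>lborel)"
    proof (intro nn_integral_cong)
      fix w :: 'a
      have "(1/2) *\<^sub>R (x + (x + w)) = x + (1/2) *\<^sub>R w"
        by (simp add: scaleR_add_right flip: add.assoc scaleR_left_distrib)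
      then show "A x (x + w) = ennreal (\<bar>v (x, 0) - v (x + (1/2) *\<^sub>R w, norm w)\<bar> powr p / norm w powr ?e)"
        by (simp add: A_def)
    qed
    finally show "(\<integral>\<^sup>+y. A x y \<partial>lborel) = \<dots>" .
  qed
  have "besov_energy s p (\<lambda>x. v (x, 0)) \<le> (\<integral>\<^sup>+y. (\<integral>\<^sup>+x. ennreal (2 powr p) * (A x y + A y x) \<partial>lborel) \<partial>lborel)"
    unfolding besov_energy_def
  proof (intro nn_integral_mono)
    fix x y :: 'a
    define z where "z = ((1/2) *\<^sub>R (x + y), norm (x - y))"
    have "\<bar>v (x, 0) - v (y, 0)\<bar> powr p \<le> (\<bar>v (x, 0) - v z\<bar> + \<bar>v (y, 0) - v z\<bar>) powr p"
      using assms(2) by (intro powr_mono2) auto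
    also have "\<dots> \<le> 2 powr p * (\<bar>v (x, 0) - v z\<bar> powr p + \<bar>v (y, 0) - v z\<bar> powr p)"
      using assms(2) by (intro powr_add_le) auto
    finally have "\<bar>v (x, 0) - v (y, 0)\<bar> powr p / norm (x - y) powr ?e
        \<le> 2 powr p * (\<bar>v (x, 0) - v z\<bar> powr p + \<bar>v (y, 0) - v z\<bar> powr p) / norm (x - y) powr ?e"
      by (rule divide_right_mono) simp
    also have "\<dots> = 2 powr p * (\<bar>v (x, 0) - v z\<bar> powr p / norm (x - y) powr ?e
        + \<bar>v (y, 0) - v z\<bar> powr p / norm (x - y) powr ?e)"
      by (simp add: add_divide_distrib distrib_left)
    finally show "ennreal (\<bar>v (x, 0) - v (y, 0)\<bar> powr p / norm (x - y) powr ?e)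
        \<le> ennreal (2 powr p) * (A x y + A y x)"
      unfolding A_def
      by (subst ennreal_plus[symmetric], simp, simp, subst ennreal_mult'[symmetric], simp)
        (simp add: z_def add.commute norm_minus_commute ennreal_leI)
  qed
  also have "\<dots> = ennreal (2 powr p) *
      ((\<integral>\<^sup>+y. (\<integral>\<^sup>+x. A x y \<partial>lborel) \<partial>lborel) + (\<integral>\<^sup>+y. (\<integral>\<^sup>+x. A y x \<partial>lborel) \<partial>lborel))"
    by (simp add: nn_integral_add nn_integral_cmult)
  also have "(\<integral>\<^sup>+y. (\<integral>\<^sup>+x. A x y \<partial>lborel) \<partial>lborel) = (\<integral>\<^sup>+x. (\<integral>\<^sup>+y. A x y \<partial>lborel) \<partial>lborel)"
    by (rule lborel_pair.Fubini') simp
  finally show ?thesis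
    by (simp add: cone ennreal_mult mult.assoc mult_2)
qed

text \<open>A form of Hardy's inequality.  At the parameter \<open>\<theta>\<close> the segment has reached the height
  \<open>\<theta> ^ m |w|\<close>; the dilation \<open>w \<mapsto> \<theta> ^ m w\<close> normalises this height and costs the factor
  \<open>\<theta> powr (- m (p - s p))\<close>, which is compensated by \<open>\<theta> powr ((m - 1) p)\<close> exactly when \<open>m s \<ge> 1\<close>.\<close>
lemma cone_energy_le_weighted:
  fixes v :: "'a::euclidean_space \<times> real \<Rightarrow> real"
  assumes v: "C_k 1 v" and p: "p > 1" and m: "m \<ge> 2" "real m * s \<ge> 1" and a: "a = p * (1 - s) - 1"
  shows "cone_energy s p v \<le>
    ennreal ((2 * real m) powr p * (real DIM('a) * unit_ball_vol (real DIM('a))))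
    * (\<integral>\<^sup>+z. ennreal (norm (gradient v z) powr p) \<partial>weighted_measure a)"
proof -
  let ?n = "DIM('a)"
  let ?c = "ennreal ((2 * real m) powr p)" and ?b = "real ?n * unit_ball_vol (real ?n)"
  define e where "e = real ?n + s * p"
  define g where "g z = ennreal (norm (gradient v z) powr p)" for z
  define K where "K w = ennreal (norm w powr (p - e))" for w :: 'a
  define \<Theta> where "\<Theta> \<theta> = ennreal ((\<bar>\<theta>\<bar> ^ (m - 1)) powr p) * indicator {0..1} \<theta>" for \<theta> :: real
  define G where "G h = (\<integral>\<^sup>+x. g (x, h) \<partial>lborel)" for h
  define \<Phi> where "\<Phi> x w \<theta> = ?c * (\<Theta> \<theta> * (K w * g ((\<theta> ^ m / 2) *\<^sub>R w + x, \<theta> ^ m * norm w)))"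
    for x w \<theta>
  have "gradient v \<in> borel_measurable borel"
    by (rule borel_measurable_continuous_onI[OF C_k_1_continuous_gradient[OF v]])
  then have g_meas [measurable]: "g \<in> borel_measurable borel"
    unfolding g_def by measurable
  have [measurable]: "K \<in> borel_measurable borel" "\<Theta> \<in> borel_measurable borel"
    unfolding K_def \<Theta>_def by measurable
  have [measurable]: "G \<in> borel_measurable borel"
    unfolding G_def by measurable

  have "cone_energy s p v \<le> (\<integral>\<^sup>+x. (\<integral>\<^sup>+w. (\<integral>\<^sup>+\<theta>. \<Phi> x w \<theta> \<partial>lborel) \<partial>lborel) \<partial>lborel)"
    unfolding cone_energy_def e_def[symmetric]
  proof (intro nn_integral_mono)
    fix x w :: 'a
    let ?d = "((1/2) *\<^sub>R w, norm w)"
    let ?I = "\<integral>\<^sup>+\<theta>\<in>{0..1}. ennreal ((\<bar>\<theta>\<bar> ^ (m - 1)) powr p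
      * norm (gradient v ((x, 0) + \<theta> ^ m *\<^sub>R ?d)) powr p) \<partial>lborel"
    show "ennreal (\<bar>v (x, 0) - v (x + (1/2) *\<^sub>R w, norm w)\<bar> powr p / norm w powr e)
      \<le> (\<integral>\<^sup>+\<theta>. \<Phi> x w \<theta> \<partial>lborel)"
    proof (cases "w = 0")
      case False
      have "norm ?d \<le> 1/2 * norm w + norm w"
        using norm_Pair_le[of "(1/2) *\<^sub>R w" "norm w"] by simp
      then have "norm ?d \<le> 2 * norm w" using norm_ge_zero[of w] by linarith
      then have "(real m * norm ?d) powr p \<le> (real m * (2 * norm w)) powr p"
        using p by (intro powr_mono2 mult_left_mono) auto
      also have "\<dots> = (2 * real m) powr p * norm w powr p"
        by (simp add: powr_mult mult_ac)
      finally have d: "(real m * norm ?d) powr p / norm w powr e \<le> (2 * real m) powr p * norm w powr (p - e)"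
        by (simp add: powr_diff divide_right_mono)
      have "ennreal (\<bar>v (x, 0) - v (x + (1/2) *\<^sub>R w, norm w)\<bar> powr p / norm w powr e)
        = ennreal (1 / norm w powr e) * ennreal (\<bar>v ((x, 0) + ?d) - v (x, 0)\<bar> powr p)"
        by (simp add: ennreal_mult'[symmetric] abs_minus_commute)
      also have "\<dots> \<le> ennreal (1 / norm w powr e) * (ennreal ((real m * norm ?d) powr p) * ?I)"
        using m by (intro mult_left_mono powr_increment_le v p) auto
      also have "\<dots> = ennreal ((real m * norm ?d) powr p / norm w powr e) * ?I"
        by (simp add: ennreal_mult'[symmetric] flip: mult.assoc)
      also have "\<dots> \<le> (?c * K w) * ?I"
        unfolding K_def using d by (intro mult_right_mono) (auto simp: ennreal_mult'[symmetric] ennreal_leI)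
      also have "\<dots> = (?c * K w) * (\<integral>\<^sup>+\<theta>. \<Theta> \<theta> * g ((\<theta> ^ m / 2) *\<^sub>R w + x, \<theta> ^ m * norm w) \<partial>lborel)"
        by (auto intro!: arg_cong2[where f = "(*)"] nn_integral_cong
            simp: \<Theta>_def g_def ennreal_mult' mult_ac add.commute)
      also have "\<dots> = (\<integral>\<^sup>+\<theta>. \<Phi> x w \<theta> \<partial>lborel)"
        unfolding \<Phi>_def by (subst nn_integral_cmult[symmetric]) (auto simp: mult_ac)
      finally show ?thesis .
    qed simp
  qed
  also have "\<dots> = (\<integral>\<^sup>+x. (\<integral>\<^sup>+\<theta>. (\<integral>\<^sup>+w. \<Phi> x w \<theta> \<partial>lborel) \<partial>lborel) \<partial>lborel)"
    unfolding \<Phi>_def by (intro nn_integral_cong lborel_pair.Fubini') measurable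
  also have "\<dots> = (\<integral>\<^sup>+\<theta>. (\<integral>\<^sup>+x. (\<integral>\<^sup>+w. \<Phi> x w \<theta> \<partial>lborel) \<partial>lborel) \<partial>lborel)"
    unfolding \<Phi>_def by (intro lborel_pair.Fubini') measurable
  also have "\<dots> = (\<integral>\<^sup>+\<theta>. (\<integral>\<^sup>+w. (\<integral>\<^sup>+x. \<Phi> x w \<theta> \<partial>lborel) \<partial>lborel) \<partial>lborel)"
    unfolding \<Phi>_def by (intro nn_integral_cong lborel_pair.Fubini') measurable
  also have "\<dots> = (\<integral>\<^sup>+\<theta>. (\<integral>\<^sup>+w. ?c * (\<Theta> \<theta> * (K w * G (\<theta> ^ m * norm w))) \<partial>lborel) \<partial>lborel)"
  proof (intro nn_integral_cong)
    fix \<theta> and w :: 'a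
    have "(\<integral>\<^sup>+x. g ((\<theta> ^ m / 2) *\<^sub>R w + x, \<theta> ^ m * norm w) \<partial>lborel) = G (\<theta> ^ m * norm w)"
      unfolding G_def
      by (rule nn_integral_lborel_translate[where f = "\<lambda>x. g (x, \<theta> ^ m * norm w)"]) measurable
    then show "(\<integral>\<^sup>+x. \<Phi> x w \<theta> \<partial>lborel) = ?c * (\<Theta> \<theta> * (K w * G (\<theta> ^ m * norm w)))"
      unfolding \<Phi>_def by (simp add: nn_integral_cmult)
  qed
  also have "\<dots> = ?c * (\<integral>\<^sup>+\<theta>. \<Theta> \<theta> * (\<integral>\<^sup>+w. K w * G (\<theta> ^ m * norm w) \<partial>lborel) \<partial>lborel)"
    by (simp add: nn_integral_cmult)
  also have "\<dots> \<le> ?c * (\<integral>\<^sup>+\<theta>. indicator {0..1::real} \<theta> * (\<integral>\<^sup>+w. K w * G (norm w) \<partial>lborel) \<partial>lborel)"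
  proof (intro mult_left_mono nn_integral_mono)
    fix \<theta> :: real
    let ?L = "\<integral>\<^sup>+w. K w * G (\<theta> ^ m * norm w) \<partial>lborel"
    show "\<Theta> \<theta> * ?L \<le> indicator {0..1} \<theta> * (\<integral>\<^sup>+w. K w * G (norm w) \<partial>lborel)"
    proof (cases "\<theta> \<in> {0<..1}")
      case True
      define r where "r = \<theta> ^ m"
      have r: "r > 0" using True by (simp add: r_def)
      have "(\<integral>\<^sup>+w. K w * G (norm w) \<partial>lborel)
        = ennreal (r ^ ?n) * (\<integral>\<^sup>+w. K (r *\<^sub>R w) * G (r * norm w) \<partial>lborel)"
        using r by (subst nn_integral_lborel_affine[of _ r 0]) (auto)
      also have "\<dots> = ennreal (r ^ ?n) * (\<integral>\<^sup>+w. ennreal (r powr (p - e)) * (K w * G (r * norm w)) \<partial>lborel)"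
        using r by (simp add: K_def powr_mult ennreal_mult' mult.assoc)
      also have "\<dots> = ennreal (r ^ ?n * r powr (p - e)) * ?L"
        using r by (simp add: nn_integral_cmult ennreal_mult r_def mult.assoc)
      also have "r ^ ?n * r powr (p - e) = r powr (p - s * p)"
        using r by (simp add: powr_realpow[symmetric] e_def flip: powr_add)
      finally have L: "(\<integral>\<^sup>+w. K w * G (norm w) \<partial>lborel) = ennreal (r powr (p - s * p)) * ?L" .
      have "(\<bar>\<theta>\<bar> ^ (m - 1)) powr p = \<theta> powr (real (m - 1) * p)"
        using True by (simp add: powr_realpow[symmetric] powr_powr)
      also have "\<dots> \<le> \<theta> powr (real m * (p - s * p))"
      proof -
        \<comment> \<open>Here \<open>m s \<ge> 1\<close> makes the remaining power of \<open>\<theta>\<close> nonnegative.\<close>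
        have "p * 1 \<le> p * (real m * s)" using m p by (intro mult_left_mono) auto
        then have "real m * (p - s * p) \<le> real (m - 1) * p"
          using m by (simp add: of_nat_diff algebra_simps)
        then show ?thesis using True by (intro powr_mono') auto
      qed
      also have "\<dots> = r powr (p - s * p)"
        using True by (simp add: r_def powr_realpow[symmetric] powr_powr)
      finally have "ennreal ((\<bar>\<theta>\<bar> ^ (m - 1)) powr p) * ?L \<le> ennreal (r powr (p - s * p)) * ?L"
        by (intro mult_right_mono ennreal_leI) auto
      with True show ?thesis by (simp add: L \<Theta>_def)
    next
      case False
      \<comment> \<open>At \<open>\<theta> = 0\<close> the dilation degenerates, but there \<open>\<theta> ^ (m - 1)\<close> vanishes since \<open>m \<ge> 2\<close>.\<close>
      then have "\<theta> = 0 \<or> \<theta> \<notin> {0..1}" by auto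
      with m have "\<Theta> \<theta> = 0" by (auto simp: \<Theta>_def)
      then show ?thesis by simp
    qed
  qed auto
  also have "\<dots> = ?c * (\<integral>\<^sup>+w. K (w :: 'a) * G (norm w) \<partial>lborel)"
    by (simp add: nn_integral_multc)
  also have "(\<integral>\<^sup>+w. K (w :: 'a) * G (norm w) \<partial>lborel)
    = ennreal ?b * (\<integral>\<^sup>+h\<in>{0..}. ennreal (h ^ (?n - 1)) * (ennreal (h powr (p - e)) * G h) \<partial>lborel)"
    unfolding K_def by (rule nn_integral_norm_polar) measurable
  also have "(\<integral>\<^sup>+h\<in>{0..}. ennreal (h ^ (?n - 1)) * (ennreal (h powr (p - e)) * G h) \<partial>lborel)
    \<le> (\<integral>\<^sup>+h. ennreal (\<bar>h\<bar> powr a) * G h \<partial>lborel)"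
  proof (intro nn_integral_mono)
    fix h :: real
    have "h ^ (?n - 1) * h powr (p - e) = \<bar>h\<bar> powr a" if "h > 0"
      using that by (simp add: powr_realpow[symmetric] e_def a of_nat_diff algebra_simps flip: powr_add)
    then have "ennreal (h ^ (?n - 1)) * ennreal (h powr (p - e)) = ennreal (\<bar>h\<bar> powr a)" if "h \<ge> 0"
      using that by (cases "h = 0") (auto simp: ennreal_mult'[symmetric])
    then show "ennreal (h ^ (?n - 1)) * (ennreal (h powr (p - e)) * G h) * indicator {0..} h
      \<le> ennreal (\<bar>h\<bar> powr a) * G h"
      by (auto simp: indicator_def simp flip: mult.assoc)
  qed
  also have "(\<integral>\<^sup>+h. ennreal (\<bar>h\<bar> powr a) * G h \<partial>lborel) = (\<integral>\<^sup>+z. g z \<partial>weighted_measure a)"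
    by (simp add: G_def nn_integral_cmult nn_integral_weighted_measure)
  finally show ?thesis
    unfolding g_def by (simp add: ennreal_mult mult.assoc mult_left_mono)
qed

section \<open>Averages over the tent kernel\<close>

definition tent :: "'a::euclidean_space \<Rightarrow> real" where
  "tent y = max 0 (1 - norm y)"

definition tent_mass :: "'a::euclidean_space itself \<Rightarrow> real" where
  "tent_mass _ = (\<integral>y. tent (y :: 'a) \<partial>lborel)"

definition tent_average :: "('a::euclidean_space \<Rightarrow> real) \<Rightarrow> 'a \<times> real \<Rightarrow> real" where
  "tent_average u z = (\<integral>y. u (fst z + snd z *\<^sub>R y) * tent y \<partial>lborel) / tent_mass TYPE('a)"

lemma tent_nonneg [simp]: "tent y \<ge> 0"
  by (simp add: tent_def)

lemma continuous_on_tent: "continuous_on S tent"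
  unfolding tent_def by (intro continuous_intros)

lemma borel_measurable_tent [measurable]: "tent \<in> borel_measurable borel"
  by (rule borel_measurable_continuous_onI[OF continuous_on_tent])

lemma integrable_mult_tent:
  "continuous_on UNIV h \<Longrightarrow> integrable lborel (\<lambda>y. h y * tent y)"
  by (rule integrable_continuous_compact_support[where S = "cball 0 1"])
    (auto intro!: continuous_intros continuous_on_tent simp: tent_def)

lemma integrable_tent: "integrable lborel tent"
  using integrable_mult_tent[of "\<lambda>_. 1"] by simp

lemma tent_mass_pos: "tent_mass TYPE('a::euclidean_space) > 0"
proof -
  have "0 < 1/2 * measure lborel (ball (0::'a) (1/2))"
    using content_ball_pos[of "1/2" "0::'a"] by simp
  also have "\<dots> = (\<integral>y. 1/2 * indicator (ball (0::'a) (1/2)) y \<partial>lborel)" by simp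
  also have "\<dots> \<le> tent_mass TYPE('a)"
    unfolding tent_mass_def
  proof (rule integral_mono)
    show "integrable lborel (\<lambda>y. 1/2 * indicator (ball (0::'a) (1/2)) y :: real)"
      by (intro integrable_mult_right integrable_real_indicator)
        (use emeasure_lborel_ball_finite[of "0::'a" "1/2"] in simp_all)
  qed (auto simp: integrable_tent tent_def indicator_def)
  finally show ?thesis .
qed

text \<open>The variable \<open>t\<close> enters only through the smooth function \<open>u (x + t y)\<close>, so there is no singularity
  at \<open>t = 0\<close>, and the tent contributes only its continuity.\<close>
lemma C_k_tent_average:
  fixes u :: "'a::euclidean_space \<Rightarrow> real"
  assumes "C_k k u"
  shows "C_k k (tent_average u)"
proof -
  define F where "F w = u (fst (fst w) + snd (fst w) *\<^sub>R snd w)" for w :: "('a \<times> real) \<times> 'a"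
  have F: "C_k k F"
    unfolding F_def
  proof (rule C_k_compose[OF assms])
    fix b :: 'a
    have lin: "bounded_linear (\<lambda>w :: ('a \<times> real) \<times> 'a. fst (fst w) \<bullet> b)"
      "bounded_linear (\<lambda>w :: ('a \<times> real) \<times> 'a. snd (fst w))"
      "bounded_linear (\<lambda>w :: ('a \<times> real) \<times> 'a. snd w \<bullet> b)"
      unfolding linear_conv_bounded_linear[symmetric]
      by (rule linearI; simp add: inner_add_left)+
    have "C_k k (\<lambda>w :: ('a \<times> real) \<times> 'a. fst (fst w) \<bullet> b + snd (fst w) * (snd w \<bullet> b))"
      by (rule C_k_add[OF C_k_linear[OF lin(1)] C_k_mult[OF C_k_linear[OF lin(2)] C_k_linear[OF lin(3)]]])
    then show "C_k k (\<lambda>w :: ('a \<times> real) \<times> 'a. (fst (fst w) + snd (fst w) *\<^sub>R snd w) \<bullet> b)"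
      by (simp add: inner_add_left)
  qed
  have "integral (cbox (-One) One) (\<lambda>y. F (z, y) * tent y) / tent_mass TYPE('a) = tent_average u z" for z
  proof -
    have box: "y \<in> cbox (-One) One" if "norm y \<le> 1" for y :: 'a
      unfolding mem_box
    proof
      fix b :: 'a assume "b \<in> Basis"
      have "\<bar>y \<bullet> b\<bar> \<le> 1" using Basis_le_norm[OF \<open>b \<in> Basis\<close>, of y] that by (rule order_trans)
      then have "- 1 \<le> y \<bullet> b" "y \<bullet> b \<le> 1" by linarith+
      moreover have "One \<bullet> b = 1" using \<open>b \<in> Basis\<close> by simp
      ultimately show "(- One) \<bullet> b \<le> y \<bullet> b \<and> y \<bullet> b \<le> One \<bullet> b"
        by (simp only: inner_minus_left simp_thms)
    qed
    have supp: "F (z, y) * tent y = 0" if "y \<notin> cbox (-One) One" for y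
    proof -
      have "norm y > 1" using box[of y] that by (meson not_le)
      then show ?thesis by (simp add: tent_def)
    qed
    have cont: "continuous_on UNIV (\<lambda>y. F (z, y))"
      by (rule continuous_on_compose2[OF C_k_continuous_on[OF F, of UNIV]])
        (intro continuous_intros, simp)
    have "((\<lambda>y. F (z, y) * tent y) has_integral (\<integral>y. F (z, y) * tent y \<partial>lborel)) UNIV"
      by (rule has_integral_integral_lborel[OF integrable_mult_tent[OF cont]])
    then have "((\<lambda>y. if y \<in> cbox (-One) One then F (z, y) * tent y else 0) has_integral
        (\<integral>y. F (z, y) * tent y \<partial>lborel)) UNIV"
      by (rule has_integral_eq[rotated]) (simp add: supp)
    then have "((\<lambda>y. F (z, y) * tent y) has_integral (\<integral>y. F (z, y) * tent y \<partial>lborel)) (cbox (-One) One)"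
      unfolding has_integral_restrict_UNIV .
    then show ?thesis
      by (simp add: integral_unique tent_average_def F_def)
  qed
  moreover have "C_k k (\<lambda>z. integral (cbox (-One) One) (\<lambda>y. F (z, y) * tent y) / tent_mass TYPE('a))"
    using C_k_mult[OF C_k_integral[OF continuous_on_tent F, of "-One" One] C_k_const[of k "1 / tent_mass TYPE('a)"]]
    by simp
  ultimately show ?thesis by simp
qed

lemma tent_average_0 [simp]: "tent_average u (x, 0) = u x"
  using tent_mass_pos[where 'a = 'a] by (simp add: tent_average_def tent_mass_def)

text \<open>For \<open>t \<noteq> 0\<close> this is \<open>|t| * tent ((z - x) / t)\<close> with \<open>P = (x, t)\<close>; the factor \<open>|t|\<close> makes it
  Lipschitz in \<open>P\<close>.\<close>
definition tent_kernel :: "'a::euclidean_space \<times> real \<Rightarrow> 'a \<Rightarrow> real" where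
  "tent_kernel P z = max 0 (\<bar>snd P\<bar> - norm (z - fst P))"

lemma continuous_on_tent_kernel: "continuous_on S (tent_kernel P)"
  unfolding tent_kernel_def by (intro continuous_intros)

lemma integrable_mult_tent_kernel:
  "continuous_on UNIV h \<Longrightarrow> integrable lborel (\<lambda>z. h z * tent_kernel P z)"
  by (rule integrable_continuous_compact_support[where S = "cball (fst P) \<bar>snd P\<bar>"])
    (auto intro!: continuous_intros continuous_on_tent_kernel
      simp: tent_kernel_def dist_norm norm_minus_commute)

text \<open>The substitution \<open>z = x + t y\<close>.  Multiplication by \<open>|t| ^ (n + 1)\<close> clears the Jacobian and
  the factor \<open>|t|\<close> in the kernel, so that the identity also holds for \<open>t = 0\<close>, and a constant can
  be subtracted because the average of a constant is that constant.\<close>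
lemma tent_average_minus_const:
  fixes u :: "'a::euclidean_space \<Rightarrow> real"
  assumes u: "continuous_on UNIV u"
  shows "\<bar>snd P\<bar> ^ (DIM('a) + 1) * (tent_average u P - c)
    = (\<integral>z. (u z - c) * tent_kernel P z \<partial>lborel) / tent_mass TYPE('a)"
proof (cases "snd P = 0")
  case True
  then have "tent_kernel P = (\<lambda>z. 0)" by (auto simp: tent_kernel_def)
  with True show ?thesis by simp
next
  case False
  let ?W = "tent_mass TYPE('a)" and ?t = "snd P"
  let ?h = "\<lambda>y. u (fst P + ?t *\<^sub>R y)"
  have W: "?W > 0" by (rule tent_mass_pos)
  have h: "continuous_on UNIV ?h"
    by (rule continuous_on_compose2[OF u]) (auto intro!: continuous_intros)
  have kernel: "\<bar>?t\<bar> * tent y = tent_kernel P (fst P + ?t *\<^sub>R y)" for y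
  proof -
    have "\<bar>?t\<bar> * max 0 (1 - norm y) = max (\<bar>?t\<bar> * 0) (\<bar>?t\<bar> * (1 - norm y))"
      by (subst max_mult_distrib_left) simp
    then show ?thesis
      by (simp add: tent_def tent_kernel_def right_diff_distrib)
  qed
  have "tent_average u P - c = ((\<integral>y. ?h y * tent y \<partial>lborel) - c * (\<integral>y. tent (y::'a) \<partial>lborel)) / ?W"
    using W unfolding tent_average_def tent_mass_def by (simp add: diff_divide_distrib)
  also have "(\<integral>y. ?h y * tent y \<partial>lborel) - c * (\<integral>y. tent (y::'a) \<partial>lborel)
      = (\<integral>y. (?h y - c) * tent y \<partial>lborel)"
    by (simp add: left_diff_distrib integrable_mult_tent[OF h] integrable_tent)
  also have "\<bar>?t\<bar> ^ (DIM('a) + 1) * (\<dots> / ?W)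
      = (\<bar>?t\<bar> ^ DIM('a) * (\<integral>y. \<bar>?t\<bar> * ((?h y - c) * tent y) \<partial>lborel)) / ?W"
    by simp
  also have "(\<lambda>y. \<bar>?t\<bar> * ((?h y - c) * tent y)) = (\<lambda>y. (?h y - c) * (\<bar>?t\<bar> * tent y))"
    by (simp only: mult.left_commute)
  also have "(\<lambda>y. (?h y - c) * (\<bar>?t\<bar> * tent y))
      = (\<lambda>y. (?h y - c) * tent_kernel P (fst P + ?t *\<^sub>R y))"
    by (simp only: kernel)
  also have "\<bar>?t\<bar> ^ DIM('a) * (\<integral>y. (?h y - c) * tent_kernel P (fst P + ?t *\<^sub>R y) \<partial>lborel)
      = (\<integral>z. (u z - c) * tent_kernel P z \<partial>lborel)"
    using False u continuous_on_tent_kernel[of UNIV P]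
    by (subst lborel_integral_affine[of _ ?t "fst P"])
      (auto intro!: borel_measurable_continuous_onI continuous_intros)
  finally show ?thesis .
qed

lemma tent_kernel_Lipschitz:
  fixes P P\<^sub>0 :: "'a::euclidean_space \<times> real"
  assumes "2 * norm (P - P\<^sub>0) \<le> \<bar>snd P\<^sub>0\<bar>"
  shows "\<bar>tent_kernel P z - tent_kernel P\<^sub>0 z\<bar>
    \<le> 2 * norm (P - P\<^sub>0) * indicator (cball (fst P\<^sub>0) (2 * \<bar>snd P\<^sub>0\<bar>)) z"
proof -
  have 1: "norm (fst P - fst P\<^sub>0) \<le> norm (P - P\<^sub>0)"
    using norm_fst_le[of "fst (P - P\<^sub>0)" "snd (P - P\<^sub>0)"] unfolding prod.collapse by simp
  have 2: "\<bar>snd P - snd P\<^sub>0\<bar> \<le> norm (P - P\<^sub>0)"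
    using norm_snd_le[of "snd (P - P\<^sub>0)" "fst (P - P\<^sub>0)"] unfolding prod.collapse by simp
  have 3: "\<bar>norm (z - fst P) - norm (z - fst P\<^sub>0)\<bar> \<le> norm (fst P - fst P\<^sub>0)"
    using norm_triangle_ineq3[of "z - fst P" "z - fst P\<^sub>0"] by (simp add: norm_minus_commute)
  show ?thesis
  proof (cases "z \<in> cball (fst P\<^sub>0) (2 * \<bar>snd P\<^sub>0\<bar>)")
    case True
    then show ?thesis
      using 1 2 3 unfolding tent_kernel_def by (simp add: max_def) linarith
  next
    case False
    then have "norm (z - fst P\<^sub>0) > 2 * \<bar>snd P\<^sub>0\<bar>" by (simp add: dist_norm norm_minus_commute)
    then have "tent_kernel P z = 0" "tent_kernel P\<^sub>0 z = 0"
      using 1 2 3 assms unfolding tent_kernel_def by auto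
    then show ?thesis by simp
  qed
qed

definition local_oscillation :: "('a::euclidean_space \<Rightarrow> real) \<Rightarrow> 'a \<Rightarrow> real \<Rightarrow> real" where
  "local_oscillation u x \<rho> = (\<integral>z. \<bar>u z - u x\<bar> * indicator (cball x \<rho>) z \<partial>lborel)"

lemma integrable_local_oscillation:
  fixes u :: "'a::euclidean_space \<Rightarrow> real"
  assumes "continuous_on UNIV u"
  shows "integrable lborel (\<lambda>z. \<bar>u z - u x\<bar> * indicator (cball x \<rho>) z)"
proof -
  have "continuous_on (cball x \<rho>) (\<lambda>z. \<bar>u z - u x\<bar>)"
    by (intro continuous_intros continuous_on_subset[OF assms]) auto
  from borel_integrable_compact[OF compact_cball this]
  show ?thesis by (simp add: mult.commute)
qed

text \<open>Put \<open>A = |t| ^ (n + 1) * (U - u x)\<close> with \<open>x\<close> frozen.  By \<open>tent_average_minus_const\<close>, \<open>A\<close> is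
  an integral of \<open>u z - u x\<close> against a Lipschitz kernel, so both its value and its gradient at
  \<open>(x, t)\<close> are controlled by the oscillation of \<open>u\<close> near \<open>x\<close>.  The product rule then isolates the
  gradient of \<open>U\<close>.\<close>
lemma gradient_tent_average_le:
  fixes u :: "'a::euclidean_space \<Rightarrow> real"
  assumes u: "C_k 1 u" and "t \<noteq> 0"
  shows "norm (gradient (tent_average u) (x, t)) \<le>
    (real DIM('a) + 3) / tent_mass TYPE('a) * local_oscillation u x (2 * \<bar>t\<bar>) / \<bar>t\<bar> ^ (DIM('a) + 1)"
proof -
  let ?n = "DIM('a)" and ?W = "tent_mass TYPE('a)" and ?U = "tent_average u"
  define I where "I = local_oscillation u x (2 * \<bar>t\<bar>)"
  define P\<^sub>0 where "P\<^sub>0 = (x, t)"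
  define N where "N P = (\<integral>z. (u z - u x) * tent_kernel P z \<partial>lborel)" for P
  define A where "A P = \<bar>snd P\<bar> ^ (?n + 1) * (?U P - u x)" for P
  have W: "?W > 0" by (rule tent_mass_pos)
  have cont: "continuous_on UNIV u" using C_k_continuous_on[OF u] .
  have A: "A P = N P / ?W" for P
    unfolding A_def N_def by (rule tent_average_minus_const[OF cont])
  have N_int: "integrable lborel (\<lambda>z. (u z - u x) * tent_kernel P z)" for P
    by (intro integrable_mult_tent_kernel continuous_intros cont)
  have bound: "\<bar>\<integral>z. f z \<partial>lborel\<bar> \<le> M * I"
    if "integrable lborel f"
      and "\<And>z. \<bar>f z\<bar> \<le> M * (\<bar>u z - u x\<bar> * indicator (cball x (2 * \<bar>t\<bar>)) z)" for f M
  proof -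
    have "\<bar>\<integral>z. f z \<partial>lborel\<bar> \<le> (\<integral>z. \<bar>f z\<bar> \<partial>lborel)"
      using integral_abs_bound by simp
    also have "\<dots> \<le> (\<integral>z. M * (\<bar>u z - u x\<bar> * indicator (cball x (2 * \<bar>t\<bar>)) z) \<partial>lborel)"
      using that integrable_local_oscillation[OF cont, of x "2 * \<bar>t\<bar>"] by (intro integral_mono) auto
    finally show ?thesis by (simp add: I_def local_oscillation_def)
  qed
  have N_Lip: "\<bar>N P - N P\<^sub>0\<bar> \<le> 2 * norm (P - P\<^sub>0) * I" if "2 * norm (P - P\<^sub>0) \<le> \<bar>t\<bar>" for P
  proof -
    have "N P - N P\<^sub>0 = (\<integral>z. (u z - u x) * tent_kernel P z - (u z - u x) * tent_kernel P\<^sub>0 z \<partial>lborel)"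
      unfolding N_def by (rule Bochner_Integration.integral_diff[OF N_int N_int, symmetric])
    also have "\<bar>\<dots>\<bar> \<le> 2 * norm (P - P\<^sub>0) * I"
    proof (rule bound)
      fix z
      have "\<bar>tent_kernel P z - tent_kernel P\<^sub>0 z\<bar> \<le> 2 * norm (P - P\<^sub>0) * indicator (cball x (2 * \<bar>t\<bar>)) z"
        using tent_kernel_Lipschitz[of P P\<^sub>0 z] that by (simp add: P\<^sub>0_def)
      from mult_left_mono[OF this abs_ge_zero[of "u z - u x"]]
      show "\<bar>(u z - u x) * tent_kernel P z - (u z - u x) * tent_kernel P\<^sub>0 z\<bar>
          \<le> 2 * norm (P - P\<^sub>0) * (\<bar>u z - u x\<bar> * indicator (cball x (2 * \<bar>t\<bar>)) z)"
        unfolding right_diff_distrib[symmetric] abs_mult by (simp add: mult_ac)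
    qed (intro Bochner_Integration.integrable_diff N_int)
    finally show ?thesis .
  qed
  have N0: "\<bar>N P\<^sub>0\<bar> \<le> \<bar>t\<bar> * I"
    unfolding N_def
  proof (rule bound)
    fix z
    have "\<bar>tent_kernel P\<^sub>0 z\<bar> \<le> \<bar>t\<bar> * indicator (cball x (2 * \<bar>t\<bar>)) z"
      by (auto simp: tent_kernel_def P\<^sub>0_def indicator_def dist_norm norm_minus_commute)
    from mult_left_mono[OF this abs_ge_zero[of "u z - u x"]]
    show "\<bar>(u z - u x) * tent_kernel P\<^sub>0 z\<bar> \<le> \<bar>t\<bar> * (\<bar>u z - u x\<bar> * indicator (cball x (2 * \<bar>t\<bar>)) z)"
      by (simp add: abs_mult mult_ac)
  qed (rule N_int)
  have I0: "I \<ge> 0" by (simp add: I_def local_oscillation_def)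
  have diffU: "?U differentiable (at P\<^sub>0)"
    by (rule C_k_1_differentiable[OF C_k_tent_average[OF u]])
  \<comment> \<open>Up to the sign of \<open>t\<close>, the contribution of the derivative of \<open>|t| ^ (n + 1)\<close> to
    the \<open>t\<close>-component of the gradient of \<open>A\<close>.\<close>
  define q where "q = real (?n + 1) * \<bar>t\<bar> ^ ?n * (?U P\<^sub>0 - u x)"
  have pow: "((\<lambda>P :: 'a \<times> real. \<bar>snd P\<bar> ^ (?n + 1)) has_derivative
      (\<lambda>h. real (?n + 1) * (sgn t * snd h) * \<bar>t\<bar> ^ ?n)) (at P\<^sub>0)"
  proof -
    have "((\<lambda>P :: 'a \<times> real. \<bar>snd P\<bar>) has_derivative (\<lambda>h. sgn t * snd h)) (at P\<^sub>0)"
    proof (rule has_derivative_compose[where f = snd and g = abs and f' = snd and g' = "\<lambda>h. sgn t * h"])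
      show "((snd :: 'a \<times> real \<Rightarrow> real) has_derivative snd) (at P\<^sub>0)"
        by (rule bounded_linear_imp_has_derivative[OF bounded_linear_snd])
      show "(abs has_derivative (\<lambda>h. sgn t * h)) (at (snd P\<^sub>0))"
        using has_derivative_norm[of t] \<open>t \<noteq> 0\<close>
        by (simp add: P\<^sub>0_def mult.commute real_norm_def[abs_def])
    qed
    from has_derivative_power[OF this, of "?n + 1"] show ?thesis
      by (simp add: P\<^sub>0_def mult_ac)
  qed
  have "(A has_derivative (\<lambda>h. \<bar>t\<bar> ^ (?n + 1) * (gradient ?U P\<^sub>0 \<bullet> h)
      + real (?n + 1) * (sgn t * snd h) * \<bar>t\<bar> ^ ?n * (?U P\<^sub>0 - u x))) (at P\<^sub>0)"
    unfolding A_def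
    using has_derivative_mult[OF pow has_derivative_diff[OF has_derivative_gradient[OF diffU] has_derivative_const[of "u x"]]]
    by (simp add: P\<^sub>0_def)
  moreover have "\<bar>t\<bar> ^ (?n + 1) * (gradient ?U P\<^sub>0 \<bullet> h)
      + real (?n + 1) * (sgn t * snd h) * \<bar>t\<bar> ^ ?n * (?U P\<^sub>0 - u x)
      = (\<bar>t\<bar> ^ (?n + 1) *\<^sub>R gradient ?U P\<^sub>0 + (q * sgn t) *\<^sub>R (0, 1)) \<bullet> h" for h
    unfolding inner_add_left inner_scaleR_left q_def by (cases h) (simp add: algebra_simps)
  ultimately have A': "(A has_derivative
      (\<lambda>h. (\<bar>t\<bar> ^ (?n + 1) *\<^sub>R gradient ?U P\<^sub>0 + (q * sgn t) *\<^sub>R (0, 1)) \<bullet> h)) (at P\<^sub>0)"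
    by simp
  have "norm (gradient A P\<^sub>0) \<le> 2 * I / ?W"
  proof (rule norm_gradient_le)
    show "A differentiable (at P\<^sub>0)" using A' by (auto simp: differentiable_def)
    have "\<bar>A P - A P\<^sub>0\<bar> \<le> 2 * I / ?W * norm (P - P\<^sub>0)" if "dist P P\<^sub>0 < \<bar>t\<bar> / 2" for P
    proof -
      have "\<bar>A P - A P\<^sub>0\<bar> = \<bar>N P - N P\<^sub>0\<bar> / ?W"
        using W by (simp add: A flip: diff_divide_distrib)
      also have "\<dots> \<le> (2 * norm (P - P\<^sub>0) * I) / ?W"
        using that W by (intro divide_right_mono N_Lip) (auto simp: dist_norm)
      finally show ?thesis by (simp add: mult_ac)
    qed
    then show "\<forall>\<^sub>F P in at P\<^sub>0. \<bar>A P - A P\<^sub>0\<bar> \<le> 2 * I / ?W * norm (P - P\<^sub>0)"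
      using \<open>t \<noteq> 0\<close> unfolding eventually_at by (intro exI[of _ "\<bar>t\<bar> / 2"]) auto
  qed (use I0 W in simp)
  then have gA: "norm (\<bar>t\<bar> ^ (?n + 1) *\<^sub>R gradient ?U P\<^sub>0 + (q * sgn t) *\<^sub>R (0, 1)) \<le> 2 * I / ?W"
    by (simp only: gradient_eqI[OF A'])
  have q: "\<bar>q\<bar> \<le> (real ?n + 1) * I / ?W"
  proof -
    have "\<bar>t\<bar> * \<bar>q\<bar> = real (?n + 1) * \<bar>A P\<^sub>0\<bar>"
      by (simp add: q_def A_def P\<^sub>0_def abs_mult)
    also have "\<dots> \<le> real (?n + 1) * (\<bar>t\<bar> * I / ?W)"
      using N0 W by (intro mult_left_mono) (auto simp: A divide_right_mono)
    finally have "\<bar>t\<bar> * \<bar>q\<bar> \<le> \<bar>t\<bar> * ((real ?n + 1) * I / ?W)"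
      by (simp add: mult_ac add.commute)
    then show ?thesis
      by (rule mult_left_le_imp_le) (use \<open>t \<noteq> 0\<close> in simp)
  qed
  have "\<bar>t\<bar> ^ (?n + 1) * norm (gradient ?U P\<^sub>0) = norm (\<bar>t\<bar> ^ (?n + 1) *\<^sub>R gradient ?U P\<^sub>0)"
    by simp
  also have "\<dots> \<le> norm (\<bar>t\<bar> ^ (?n + 1) *\<^sub>R gradient ?U P\<^sub>0 + (q * sgn t) *\<^sub>R (0, 1))
      + norm ((q * sgn t) *\<^sub>R (0 :: 'a, 1 :: real))"
    using norm_triangle_ineq4[of "\<bar>t\<bar> ^ (?n + 1) *\<^sub>R gradient ?U P\<^sub>0 + (q * sgn t) *\<^sub>R (0, 1)"
        "(q * sgn t) *\<^sub>R (0, 1)"] by (simp only: add_diff_cancel_right')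
  also have "norm ((q * sgn t) *\<^sub>R (0 :: 'a, 1 :: real)) = \<bar>q\<bar>"
    using \<open>t \<noteq> 0\<close> by (simp add: norm_Pair abs_mult sgn_real_def)
  finally have "\<bar>t\<bar> ^ (?n + 1) * norm (gradient ?U P\<^sub>0) \<le> 2 * I / ?W + (real ?n + 1) * I / ?W"
    using gA q by linarith
  also have "\<dots> = (real ?n + 3) / ?W * I"
    by (simp add: field_simps flip: add_divide_distrib)
  finally have "norm (gradient ?U P\<^sub>0) * \<bar>t\<bar> ^ (?n + 1) \<le> (real ?n + 3) / ?W * I"
    by (simp only: mult.commute)
  then have "norm (gradient ?U P\<^sub>0) \<le> (real ?n + 3) / ?W * I / \<bar>t\<bar> ^ (?n + 1)"
    using \<open>t \<noteq> 0\<close> by (subst pos_le_divide_eq) (simp_all only: zero_less_power zero_less_abs_iff not_False_eq_True)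
  then show ?thesis by (simp only: P\<^sub>0_def I_def)
qed

lemma local_oscillation_powr_le:
  fixes u :: "'a::euclidean_space \<Rightarrow> real"
  assumes u: "continuous_on UNIV u" and "p > 1" "\<rho> \<ge> 0"
  shows "ennreal (local_oscillation u x \<rho> powr p)
    \<le> ennreal ((unit_ball_vol (real DIM('a)) * \<rho> ^ DIM('a)) powr (p - 1))
      * (\<integral>\<^sup>+z. ennreal (\<bar>u z - u x\<bar> powr p) * indicator (cball x \<rho>) z \<partial>lborel)"
proof -
  have [measurable]: "u \<in> borel_measurable borel"
    using u by (rule borel_measurable_continuous_onI)
  have "integrable lborel (indicator (cball x \<rho>) :: 'a \<Rightarrow> real)"
    using emeasure_lborel_cball_finite[of x \<rho>] by (intro integrable_real_indicator) auto
  moreover have "(\<integral>z. indicator (cball x \<rho>) z \<partial>lborel) = unit_ball_vol (real DIM('a)) * \<rho> ^ DIM('a)"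
    using content_cball[OF assms(3), of x] by simp
  moreover have "(\<integral>\<^sup>+z. ennreal (\<bar>u z - u x\<bar> powr p * indicator (cball x \<rho>) z) \<partial>lborel)
      = (\<integral>\<^sup>+z. ennreal (\<bar>u z - u x\<bar> powr p) * indicator (cball x \<rho>) z \<partial>lborel)"
    by (auto intro!: nn_integral_cong simp: indicator_def)
  ultimately show ?thesis
    using jensen_powr[of p "\<lambda>z. \<bar>u z - u x\<bar>" lborel "indicator (cball x \<rho>)"]
      integrable_local_oscillation[OF u, of x \<rho>] assms(2)
    by (simp add: local_oscillation_def)
qed

text \<open>The second factor is the power \<open>p - 1\<close>, from Jensen's inequality, of the volume of a ball of
  radius \<open>2 |t|\<close>, without its power of \<open>|t|\<close>.\<close>
definition tent_gradient_const :: "real \<Rightarrow> 'a::euclidean_space itself \<Rightarrow> real" where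
  "tent_gradient_const p _ = ((real DIM('a) + 3) / tent_mass TYPE('a)) powr p
    * (unit_ball_vol (real DIM('a)) * 2 ^ DIM('a)) powr (p - 1)"

lemma gradient_tent_average_powr_le:
  fixes u :: "'a::euclidean_space \<Rightarrow> real"
  assumes u: "C_k 1 u" and p: "p > 1" and t: "t \<noteq> 0"
  shows "ennreal (norm (gradient (tent_average u) (x, t)) powr p)
    \<le> ennreal (tent_gradient_const p TYPE('a) * \<bar>t\<bar> powr (- p - real DIM('a)))
      * (\<integral>\<^sup>+z. ennreal (\<bar>u z - u x\<bar> powr p) * indicator (cball x (2 * \<bar>t\<bar>)) z \<partial>lborel)"
proof -
  let ?n = "DIM('a)" and ?I = "local_oscillation u x (2 * \<bar>t\<bar>)" and ?\<omega> = "unit_ball_vol (real DIM('a))"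
  let ?J = "\<integral>\<^sup>+z. ennreal (\<bar>u z - u x\<bar> powr p) * indicator (cball x (2 * \<bar>t\<bar>)) z \<partial>lborel"
  define c where "c = (real ?n + 3) / tent_mass TYPE('a)"
  have c: "c \<ge> 0" using tent_mass_pos[where 'a = 'a] by (simp add: c_def)
  have cont: "continuous_on UNIV u" using C_k_continuous_on[OF u] .
  have I: "?I \<ge> 0" by (simp add: local_oscillation_def)
  have "norm (gradient (tent_average u) (x, t)) powr p \<le> (c * (?I / \<bar>t\<bar> ^ (?n + 1))) powr p"
    using gradient_tent_average_le[OF u t, of x] p by (intro powr_mono2) (auto simp: c_def)
  also have "\<dots> = c powr p * \<bar>t\<bar> powr (- p * real (?n + 1)) * ?I powr p"
  proof -
    have "(\<bar>t\<bar> ^ (?n + 1)) powr p = \<bar>t\<bar> powr (p * real (?n + 1))"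
      using t by (subst powr_realpow[symmetric]) (simp_all only: powr_powr mult.commute zero_less_abs_iff not_False_eq_True)
    then show ?thesis
      using c I by (simp add: powr_mult powr_divide powr_minus_divide)
  qed
  finally have "ennreal (norm (gradient (tent_average u) (x, t)) powr p)
      \<le> ennreal (c powr p * \<bar>t\<bar> powr (- p * real (?n + 1))) * ennreal (?I powr p)"
    by (simp add: ennreal_leI flip: ennreal_mult)
  also have "\<dots> \<le> ennreal (c powr p * \<bar>t\<bar> powr (- p * real (?n + 1)))
      * (ennreal ((?\<omega> * (2 * \<bar>t\<bar>) ^ ?n) powr (p - 1)) * ?J)"
    by (intro mult_left_mono local_oscillation_powr_le cont p) auto
  also have "\<dots> = ennreal (c powr p * \<bar>t\<bar> powr (- p * real (?n + 1))
      * (?\<omega> * (2 * \<bar>t\<bar>) ^ ?n) powr (p - 1)) * ?J"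
    by (simp add: ennreal_mult mult.assoc)
  also have "(?\<omega> * (2 * \<bar>t\<bar>) ^ ?n) powr (p - 1) = (?\<omega> * 2 ^ ?n) powr (p - 1) * \<bar>t\<bar> powr (real ?n * (p - 1))"
  proof -
    have "?\<omega> * (2 * \<bar>t\<bar>) ^ ?n = (?\<omega> * 2 ^ ?n) * \<bar>t\<bar> powr real ?n"
      using t by (simp add: power_mult_distrib powr_realpow)
    then show ?thesis by (simp only: powr_mult powr_powr)
  qed
  also have "c powr p * \<bar>t\<bar> powr (- p * real (?n + 1)) * ((?\<omega> * 2 ^ ?n) powr (p - 1) * \<bar>t\<bar> powr (real ?n * (p - 1)))
      = tent_gradient_const p TYPE('a) * (\<bar>t\<bar> powr (- p * real (?n + 1)) * \<bar>t\<bar> powr (real ?n * (p - 1)))"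
    by (simp add: tent_gradient_const_def c_def)
  also have "\<bar>t\<bar> powr (- p * real (?n + 1)) * \<bar>t\<bar> powr (real ?n * (p - 1)) = \<bar>t\<bar> powr (- p - real ?n)"
    by (simp add: algebra_simps flip: powr_add)
  finally show ?thesis .
qed

text \<open>For fixed \<open>x\<close> and \<open>z\<close> the difference \<open>u z - u x\<close> contributes only at heights
  \<open>|t| \<ge> |z - x| / 2\<close>.  There the total power of \<open>|t|\<close> is \<open>- 1 - e\<close>, whose integral is a multiple of
  \<open>|z - x| powr (- e)\<close>, the kernel of the Besov energy.\<close>
lemma tent_average_energy_le:
  fixes u :: "'a::euclidean_space \<Rightarrow> real"
  assumes u: "C_k 1 u" and p: "p > 1" and s: "s > 0" and a: "a = p * (1 - s) - 1"
  defines "e \<equiv> real DIM('a) + s * p"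
  shows "(\<integral>\<^sup>+z. ennreal (norm (gradient (tent_average u) z) powr p) \<partial>weighted_measure a)
    \<le> ennreal (tent_gradient_const p TYPE('a) * (2 powr (e + 1) / e)) * besov_energy s p u"
proof -
  let ?n = "DIM('a)" and ?\<kappa> = "tent_gradient_const p TYPE('a)"
  have e: "e > 0" using s p by (simp add: e_def add_pos_pos)
  have \<kappa>: "?\<kappa> \<ge> 0" by (simp add: tent_gradient_const_def)
  have "gradient (tent_average u) \<in> borel_measurable borel"
    by (rule borel_measurable_continuous_onI[OF C_k_1_continuous_gradient[OF C_k_tent_average[OF u]]])
  note [measurable] = this
  have [measurable]: "u \<in> borel_measurable borel"
    by (rule borel_measurable_continuous_onI[OF C_k_continuous_on[OF u]])
  define \<Phi> where "\<Phi> t x z = ennreal ?\<kappa> * (ennreal (\<bar>u z - u x\<bar> powr p)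
      * (ennreal (\<bar>t\<bar> powr (- 1 - e)) * indicator {norm (z - x) / 2..} \<bar>t\<bar>))" for t :: real and x z :: 'a
  have [measurable]: "(\<lambda>w. \<Phi> (f w) (g w) (h w)) \<in> borel_measurable M"
    if [measurable]: "f \<in> borel_measurable M" "g \<in> borel_measurable M" "h \<in> borel_measurable M" for f g h M
    unfolding \<Phi>_def indicator_def atLeast_iff by measurable
  have "(\<integral>\<^sup>+z. ennreal (norm (gradient (tent_average u) z) powr p) \<partial>weighted_measure a)
      = (\<integral>\<^sup>+t. (\<integral>\<^sup>+x. ennreal (\<bar>t\<bar> powr a) * ennreal (norm (gradient (tent_average u) (x, t)) powr p)
        \<partial>lborel) \<partial>lborel)"
    by (rule nn_integral_weighted_measure) measurable
  also have "\<dots> \<le> (\<integral>\<^sup>+t. (\<integral>\<^sup>+x. (\<integral>\<^sup>+z. \<Phi> t x z \<partial>lborel) \<partial>lborel) \<partial>lborel)"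
  proof (intro nn_integral_mono)
    fix t :: real and x :: 'a
    let ?J = "\<integral>\<^sup>+z. ennreal (\<bar>u z - u x\<bar> powr p) * indicator (cball x (2 * \<bar>t\<bar>)) z \<partial>lborel"
    show "ennreal (\<bar>t\<bar> powr a) * ennreal (norm (gradient (tent_average u) (x, t)) powr p)
      \<le> (\<integral>\<^sup>+z. \<Phi> t x z \<partial>lborel)"
    proof (cases "t = 0")
      case False
      have "ennreal (\<bar>t\<bar> powr a) * ennreal (norm (gradient (tent_average u) (x, t)) powr p)
          \<le> ennreal (\<bar>t\<bar> powr a) * (ennreal (?\<kappa> * \<bar>t\<bar> powr (- p - real ?n)) * ?J)"
        by (intro mult_left_mono gradient_tent_average_powr_le u p False) auto
      also have "\<dots> = ennreal (?\<kappa> * (\<bar>t\<bar> powr a * \<bar>t\<bar> powr (- p - real ?n))) * ?J"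
        using \<kappa> by (simp add: ennreal_mult' mult_ac)
      also have "\<bar>t\<bar> powr a * \<bar>t\<bar> powr (- p - real ?n) = \<bar>t\<bar> powr (- 1 - e)"
      proof -
        have "a + (- p - real ?n) = - 1 - e" by (simp add: a e_def algebra_simps)
        then show ?thesis by (simp flip: powr_add)
      qed
      also have "ennreal (?\<kappa> * \<bar>t\<bar> powr (- 1 - e)) * ?J = (\<integral>\<^sup>+z. \<Phi> t x z \<partial>lborel)"
        using \<kappa> unfolding \<Phi>_def
        by (subst nn_integral_cmult[symmetric])
          (auto intro!: nn_integral_cong simp: ennreal_mult' indicator_def dist_norm norm_minus_commute mult_ac)
      finally show ?thesis .
    qed simp
  qed
  also have "\<dots> = (\<integral>\<^sup>+x. (\<integral>\<^sup>+t. (\<integral>\<^sup>+z. \<Phi> t x z \<partial>lborel) \<partial>lborel) \<partial>lborel)"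
    by (intro lborel_pair.Fubini') measurable
  also have "\<dots> = (\<integral>\<^sup>+x. (\<integral>\<^sup>+z. (\<integral>\<^sup>+t. \<Phi> t x z \<partial>lborel) \<partial>lborel) \<partial>lborel)"
    by (intro nn_integral_cong lborel_pair.Fubini') measurable
  also have "\<dots> = (\<integral>\<^sup>+x. (\<integral>\<^sup>+z. ennreal (?\<kappa> * (2 powr (e + 1) / e))
      * ennreal (\<bar>u z - u x\<bar> powr p / norm (z - x) powr e) \<partial>lborel) \<partial>lborel)"
  proof (intro nn_integral_cong)
    fix x z :: 'a
    define \<rho> where "\<rho> = norm (z - x)"
    show "(\<integral>\<^sup>+t. \<Phi> t x z \<partial>lborel) = ennreal (?\<kappa> * (2 powr (e + 1) / e))
      * ennreal (\<bar>u z - u x\<bar> powr p / norm (z - x) powr e)"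
    proof (cases "z = x")
      case False
      then have \<rho>: "\<rho> > 0" by (simp add: \<rho>_def)
      have "(\<integral>\<^sup>+t. ennreal (\<bar>t\<bar> powr (- 1 - e)) * indicator {\<rho> / 2..} \<bar>t\<bar> \<partial>lborel)
          = 2 * (\<integral>\<^sup>+h\<in>{0..}. ennreal (h powr (- 1 - e)) * indicator {\<rho> / 2..} h \<partial>lborel)"
        by (rule nn_integral_abs_real) measurable
      also have "(\<integral>\<^sup>+h\<in>{0..}. ennreal (h powr (- 1 - e)) * indicator {\<rho> / 2..} h \<partial>lborel)
          = (\<integral>\<^sup>+h\<in>{\<rho> / 2..}. ennreal (h powr (- 1 - e)) \<partial>lborel)"
        using \<rho> by (intro nn_integral_cong) (auto simp: indicator_def)
      also have "\<dots> = ennreal ((\<rho> / 2) powr (- e) / e)"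
        using \<rho> e by (intro nn_integral_powr_tail) auto
      also have "2 * \<dots> = ennreal (2 * ((\<rho> / 2) powr (- e) / e))"
        by (subst ennreal_mult') simp_all
      also have "2 * ((\<rho> / 2) powr (- e) / e) = 2 powr (e + 1) / e * (1 / \<rho> powr e)"
        using \<rho> by (simp add: powr_divide powr_minus powr_add field_simps)
      finally have T: "(\<integral>\<^sup>+t. ennreal (\<bar>t\<bar> powr (- 1 - e)) * indicator {\<rho> / 2..} \<bar>t\<bar> \<partial>lborel)
          = ennreal (2 powr (e + 1) / e * (1 / \<rho> powr e))" .
      have "(\<integral>\<^sup>+t. \<Phi> t x z \<partial>lborel) = ennreal ?\<kappa> * (ennreal (\<bar>u z - u x\<bar> powr p)
          * ennreal (2 powr (e + 1) / e * (1 / \<rho> powr e)))"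
        unfolding \<Phi>_def \<rho>_def[symmetric] by (simp add: nn_integral_cmult T)
      also have "\<dots> = ennreal (?\<kappa> * (2 powr (e + 1) / e) * (\<bar>u z - u x\<bar> powr p / \<rho> powr e))"
        using \<kappa> e by (simp add: mult_ac flip: ennreal_mult)
      also have "\<dots> = ennreal (?\<kappa> * (2 powr (e + 1) / e)) * ennreal (\<bar>u z - u x\<bar> powr p / \<rho> powr e)"
        using \<kappa> e by (intro ennreal_mult) auto
      finally show ?thesis by (simp add: \<rho>_def)
    qed (simp add: \<Phi>_def)
  qed
  also have "\<dots> = ennreal (?\<kappa> * (2 powr (e + 1) / e)) * besov_energy s p u"
    by (simp add: besov_energy_def nn_integral_cmult e_def)
  finally show ?thesis .
qed

text \<open>An average over translates does not increase the norm: Jensen's inequality inside, then Fubini's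
  theorem and translation invariance.\<close>
lemma nn_integral_tent_average_powr_le:
  fixes u :: "'a::euclidean_space \<Rightarrow> real"
  assumes u: "continuous_on UNIV u" and p: "p > 1"
  shows "(\<integral>\<^sup>+x. ennreal (\<bar>tent_average u (x, t)\<bar> powr p) \<partial>lborel) \<le> (\<integral>\<^sup>+x. ennreal (\<bar>u x\<bar> powr p) \<partial>lborel)"
proof -
  let ?W = "tent_mass TYPE('a)"
  have W: "?W > 0" by (rule tent_mass_pos)
  have [measurable]: "u \<in> borel_measurable borel"
    using u by (rule borel_measurable_continuous_onI)
  have "ennreal (\<bar>tent_average u (x, t)\<bar> powr p)
    \<le> ennreal (1 / ?W) * (\<integral>\<^sup>+y. ennreal (\<bar>u (x + t *\<^sub>R y)\<bar> powr p * tent y) \<partial>lborel)" for x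
  proof -
    let ?h = "\<lambda>y. u (x + t *\<^sub>R y)"
    have h: "continuous_on UNIV ?h"
      by (rule continuous_on_compose2[OF u]) (intro continuous_intros, simp)
    have int: "integrable lborel (\<lambda>y. \<bar>?h y\<bar> * tent y)"
      by (intro integrable_mult_tent continuous_intros h)
    let ?K = "\<integral>y. \<bar>?h y\<bar> * tent y \<partial>lborel"
    have "\<bar>\<integral>y. ?h y * tent y \<partial>lborel\<bar> \<le> (\<integral>y. \<bar>?h y * tent y\<bar> \<partial>lborel)"
      by (rule integral_abs_bound)
    also have "\<dots> = ?K" by (simp add: abs_mult)
    finally have "\<bar>tent_average u (x, t)\<bar> \<le> ?K / ?W"
      using W by (simp add: tent_average_def divide_right_mono)
    then have "\<bar>tent_average u (x, t)\<bar> powr p \<le> (?K / ?W) powr p"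
      using p by (intro powr_mono2) auto
    also have "\<dots> = 1 / ?W powr p * ?K powr p"
      using W by (subst powr_divide) (auto intro!: integral_nonneg_AE)
    finally have "ennreal (\<bar>tent_average u (x, t)\<bar> powr p) \<le> ennreal (1 / ?W powr p) * ennreal (?K powr p)"
      by (simp add: ennreal_leI flip: ennreal_mult)
    also have "\<dots> \<le> ennreal (1 / ?W powr p) * (ennreal (?W powr (p - 1))
        * (\<integral>\<^sup>+y. ennreal (\<bar>?h y\<bar> powr p * tent y) \<partial>lborel))"
      unfolding tent_mass_def using p int
      by (intro mult_left_mono jensen_powr) (auto simp: integrable_tent)
    also have "\<dots> = ennreal (1 / ?W powr p * ?W powr (p - 1))
        * (\<integral>\<^sup>+y. ennreal (\<bar>?h y\<bar> powr p * tent y) \<partial>lborel)"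
      by (subst ennreal_mult, simp, simp, simp only: mult.assoc)
    also have "1 / ?W powr p * ?W powr (p - 1) = 1 / ?W"
      using W by (simp add: powr_diff field_simps)
    finally show ?thesis .
  qed
  then have "(\<integral>\<^sup>+x. ennreal (\<bar>tent_average u (x, t)\<bar> powr p) \<partial>lborel)
    \<le> (\<integral>\<^sup>+x. ennreal (1 / ?W) * (\<integral>\<^sup>+y. ennreal (\<bar>u (x + t *\<^sub>R y)\<bar> powr p * tent y) \<partial>lborel) \<partial>lborel)"
    by (intro nn_integral_mono)
  also have "\<dots> = ennreal (1 / ?W) * (\<integral>\<^sup>+x. (\<integral>\<^sup>+y. ennreal (\<bar>u (x + t *\<^sub>R y)\<bar> powr p * tent y) \<partial>lborel) \<partial>lborel)"
    by (intro nn_integral_cmult) measurable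
  also have "(\<integral>\<^sup>+x. (\<integral>\<^sup>+y. ennreal (\<bar>u (x + t *\<^sub>R y)\<bar> powr p * tent y) \<partial>lborel) \<partial>lborel)
      = (\<integral>\<^sup>+y. (\<integral>\<^sup>+x. ennreal (\<bar>u (x + t *\<^sub>R y)\<bar> powr p * tent y) \<partial>lborel) \<partial>lborel)"
    by (intro lborel_pair.Fubini') measurable
  also have "\<dots> = (\<integral>\<^sup>+y. ennreal (tent (y :: 'a)) * (\<integral>\<^sup>+x. ennreal (\<bar>u x\<bar> powr p) \<partial>lborel) \<partial>lborel)"
  proof (intro nn_integral_cong)
    fix y :: 'a
    have "(\<integral>\<^sup>+x. ennreal (\<bar>u (x + t *\<^sub>R y)\<bar> powr p * tent y) \<partial>lborel)
        = ennreal (tent y) * (\<integral>\<^sup>+x. ennreal (\<bar>u (t *\<^sub>R y + x)\<bar> powr p) \<partial>lborel)"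
      by (simp add: ennreal_mult'' mult.commute add.commute nn_integral_cmult)
    also have "(\<integral>\<^sup>+x. ennreal (\<bar>u (t *\<^sub>R y + x)\<bar> powr p) \<partial>lborel) = (\<integral>\<^sup>+x. ennreal (\<bar>u x\<bar> powr p) \<partial>lborel)"
      by (rule nn_integral_lborel_translate[where f = "\<lambda>x. ennreal (\<bar>u x\<bar> powr p)"]) measurable
    finally show "(\<integral>\<^sup>+x. ennreal (\<bar>u (x + t *\<^sub>R y)\<bar> powr p * tent y) \<partial>lborel)
        = ennreal (tent y) * (\<integral>\<^sup>+x. ennreal (\<bar>u x\<bar> powr p) \<partial>lborel)" .
  qed
  also have "\<dots> = (\<integral>\<^sup>+y. ennreal (tent (y :: 'a)) \<partial>lborel) * (\<integral>\<^sup>+x. ennreal (\<bar>u x\<bar> powr p) \<partial>lborel)"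
    by (intro nn_integral_multc) measurable
  also have "(\<integral>\<^sup>+y. ennreal (tent (y :: 'a)) \<partial>lborel) = ennreal ?W"
    unfolding tent_mass_def by (intro nn_integral_eq_integral integrable_tent) simp
  also have "ennreal (1 / ?W) * (ennreal ?W * (\<integral>\<^sup>+x. ennreal (\<bar>u x\<bar> powr p) \<partial>lborel))
      = (\<integral>\<^sup>+x. ennreal (\<bar>u x\<bar> powr p) \<partial>lborel)"
    using W by (simp flip: mult.assoc ennreal_mult)
  finally show ?thesis .
qed

section \<open>A smooth cutoff function\<close>

text \<open>The family is closed under differentiation up to linear combinations, which makes all its
  members smooth by a single induction.\<close>
definition flat :: "nat \<Rightarrow> real \<Rightarrow> real" where
  "flat k x = (if x > 0 then exp (- 1 / x) / x ^ k else 0)"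

lemma flat_nonneg: "flat k x \<ge> 0"
  by (simp add: flat_def)

text \<open>With \<open>y = 1 / x\<close> and \<open>m = k + j\<close> this is the bound \<open>y ^ m * exp (- y) \<le> m ^ m\<close>, a consequence of
  \<open>(1 + y / m) ^ m \<le> exp y\<close>.  The case \<open>j = 2\<close> yields differentiability at 0, the case
  \<open>j = 0\<close> boundedness.\<close>
lemma flat_le: "flat k x \<le> real (k + j) ^ (k + j) * \<bar>x\<bar> ^ j"
proof (cases "x > 0 \<and> k + j > 0")
  case True
  define m where "m = k + j"
  have x: "x > 0" and m: "m > 0" using True by (auto simp: m_def)
  have "(1 + (1 / x) / real m) ^ m \<le> exp (1 / x)"
    using x m by (intro exp_ge_one_plus_x_over_n_power_n) (auto intro: order_trans[of _ 0])
  moreover have "((1 / x) / real m) ^ m \<le> (1 + (1 / x) / real m) ^ m"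
    using x by (intro power_mono) auto
  moreover have "((1 / x) / real m) ^ m = 1 / (real m ^ m * x ^ m)"
    by (simp add: power_divide power_mult_distrib mult.commute)
  ultimately have "1 / (real m ^ m * x ^ m) \<le> exp (1 / x)" by linarith
  moreover have "real m ^ m * x ^ m > 0" using x m by simp
  ultimately have "1 \<le> exp (1 / x) * (real m ^ m * x ^ m)"
    by (simp only: pos_divide_le_eq)
  then have "exp (- (1 / x)) * 1 \<le> exp (- (1 / x)) * (exp (1 / x) * (real m ^ m * x ^ m))"
    by (intro mult_left_mono) auto
  moreover have "exp (- (1 / x)) * (exp (1 / x) * (real m ^ m * x ^ m)) = real m ^ m * x ^ m"
    unfolding mult.assoc[symmetric] exp_add[symmetric] by simp
  ultimately have "exp (- 1 / x) \<le> real m ^ m * x ^ m" by simp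
  then have "exp (- 1 / x) / x ^ k \<le> real m ^ m * x ^ m / x ^ k"
    using x by (intro divide_right_mono) auto
  also have "\<dots> = real m ^ m * x ^ j" using x by (simp add: m_def power_add)
  finally show ?thesis using x by (simp add: flat_def m_def)
next
  case False
  then show ?thesis by (auto simp: flat_def)
qed

lemma flat_has_derivative:
  "(flat k has_real_derivative flat (k + 2) x - real k * flat (k + 1) x) (at x)"
proof -
  consider "x > 0" | "x < 0" | "x = 0" by linarith
  then show ?thesis
  proof cases
    case 1
    have "((\<lambda>x. exp (- 1 / x) / x ^ k) has_real_derivative
        flat (k + 2) x - real k * flat (k + 1) x) (at x)"
    proof -
      have "((\<lambda>x. exp (- 1 / x)) has_real_derivative exp (- 1 / x) * (1 / x\<^sup>2)) (at x)"
        using 1 by (auto intro!: derivative_eq_intros simp: power2_eq_square)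
      moreover have "((\<lambda>x. x ^ k) has_real_derivative real k * x ^ k / x) (at x)"
      proof -
        have "real k * x ^ (k - Suc 0) = real k * x ^ k / x" using 1 by (cases k) auto
        then show ?thesis using DERIV_pow[of k x] by simp
      qed
      ultimately have "((\<lambda>x. exp (- 1 / x) / x ^ k) has_real_derivative
          (exp (- 1 / x) * (1 / x\<^sup>2) * x ^ k - exp (- 1 / x) * (real k * x ^ k / x)) / (x ^ k * x ^ k)) (at x)"
        using 1 by (intro DERIV_divide) auto
      moreover have "(exp (- 1 / x) * (1 / x\<^sup>2) * x ^ k - exp (- 1 / x) * (real k * x ^ k / x)) / (x ^ k * x ^ k)
          = flat (k + 2) x - real k * flat (k + 1) x"
        using 1 by (simp add: flat_def power_add field_simps power2_eq_square)
      ultimately show ?thesis by simp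
    qed
    moreover have ev: "\<forall>\<^sub>F y in nhds x. exp (- 1 / y) / y ^ k = flat k y"
      using eventually_nhds_in_open[of "{0<..}" x] 1
      by (auto simp: flat_def elim!: eventually_mono)
    ultimately show ?thesis using DERIV_cong_ev[OF refl ev refl] by blast
  next
    case 2
    have ev: "\<forall>\<^sub>F y in nhds x. 0 = flat k y"
      using eventually_nhds_in_open[of "{..<0}" x] 2
      by (auto simp: flat_def elim!: eventually_mono)
    moreover have "((\<lambda>y. 0) has_real_derivative flat (k + 2) x - real k * flat (k + 1) x) (at x)"
      using 2 by (simp add: flat_def)
    ultimately show ?thesis using DERIV_cong_ev[OF refl ev refl] by blast
  next
    case 3
    define c where "c = real (k + 2) ^ (k + 2)"
    have "((\<lambda>h. flat k h / h) \<longlongrightarrow> 0) (at 0)"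
    proof (rule Lim_null_comparison)
      show "\<forall>\<^sub>F h in at 0. norm (flat k h / h) \<le> c * \<bar>h\<bar>"
      proof (intro always_eventually allI)
        fix h :: real
        have "flat k h \<le> c * \<bar>h\<bar> ^ 2" unfolding c_def by (rule flat_le)
        then show "norm (flat k h / h) \<le> c * \<bar>h\<bar>"
          using flat_nonneg[of k h]
          by (cases "h = 0") (auto simp: abs_divide divide_le_eq power2_eq_square mult_ac)
      qed
      show "((\<lambda>h. c * \<bar>h\<bar>) \<longlongrightarrow> 0) (at 0)"
        by (auto intro!: tendsto_eq_intros)
    qed
    then show ?thesis using 3 by (simp add: DERIV_def flat_def)
  qed
qed

lemma C_k_flat: "C_k j (flat k)"
proof (induction j arbitrary: k)
  case 0
  then show ?case
    using flat_has_derivative[of k] DERIV_isCont by (auto simp: continuous_on_eq_continuous_at)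
next
  case (Suc j)
  show ?case
  proof (rule C_k_SucI)
    show "(flat k has_derivative (\<lambda>h. (flat (k + 2) x - real k * flat (k + 1) x) * h)) (at x)" for x
      using flat_has_derivative[of k x] by (simp add: has_field_derivative_def)
    have "C_k j (\<lambda>x. (flat (k + 2) x + (- real k) * flat (k + 1) x) * h)" for h
      by (intro C_k_mult C_k_add Suc C_k_const)
    then show "C_k j (\<lambda>x. (flat (k + 2) x - real k * flat (k + 1) x) * h)" for h
      by simp
  qed
qed

text \<open>Any constant strictly between 1 and 4, the squares of the relative radii of the two balls, would
  serve in place of 3.  The factor \<open>exp (1/2)\<close> is the inverse of \<open>flat 0 2\<close> and makes the values on
  the smaller ball at least 1; they may exceed 1, as the values of admissible functions may.\<close>
definition cutoff :: "'b::euclidean_space \<Rightarrow> real \<Rightarrow> 'b \<Rightarrow> real" where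
  "cutoff z\<^sub>0 r z = exp (1/2) * flat 0 (3 - (norm (z - z\<^sub>0) / r)\<^sup>2)"

lemma C_k_cutoff: "C_k k (cutoff z\<^sub>0 r)"
proof -
  have inner: "C_k k (\<lambda>z :: 'a. (z - z\<^sub>0) \<bullet> (z - z\<^sub>0))"
  proof -
    have "C_k k (\<lambda>z :: 'a. (z - z\<^sub>0) \<bullet> b)" for b
    proof -
      have "C_k k (\<lambda>z :: 'a. z \<bullet> b + (- z\<^sub>0) \<bullet> b)"
        by (intro C_k_add C_k_const C_k_linear bounded_linear_inner_left)
      then show ?thesis by (simp add: inner_diff_left)
    qed
    then have "C_k k (\<lambda>z :: 'a. \<Sum>b\<in>Basis. ((z - z\<^sub>0) \<bullet> b) * ((z - z\<^sub>0) \<bullet> b))"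
      by (intro C_k_sum C_k_mult) auto
    then show ?thesis by (simp only: euclidean_inner[symmetric])
  qed
  have "C_k k (\<lambda>z. 3 + (- 1 / r\<^sup>2) * ((z - z\<^sub>0) \<bullet> (z - z\<^sub>0)))"
    by (intro C_k_add C_k_mult C_k_const inner)
  moreover have "3 + (- 1 / r\<^sup>2) * ((z - z\<^sub>0) \<bullet> (z - z\<^sub>0)) = 3 - (norm (z - z\<^sub>0) / r)\<^sup>2" for z
    by (simp add: power_divide power2_norm_eq_inner)
  ultimately have "C_k k (\<lambda>z. 3 - (norm (z - z\<^sub>0) / r)\<^sup>2)" by simp
  then have "C_k k (\<lambda>z. flat 0 (3 - (norm (z - z\<^sub>0) / r)\<^sup>2))"
    by (intro C_k_compose[where u = "flat 0" and G = "\<lambda>z. 3 - (norm (z - z\<^sub>0) / r)\<^sup>2"] C_k_flat) auto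
  then show ?thesis
    unfolding cutoff_def[abs_def] by (intro C_k_mult C_k_const)
qed

lemma cutoff_ge_1:
  assumes "norm (z - z\<^sub>0) \<le> r" "r > 0"
  shows "cutoff z\<^sub>0 r z \<ge> 1"
proof -
  let ?q = "3 - (norm (z - z\<^sub>0) / r)\<^sup>2"
  have "(norm (z - z\<^sub>0) / r)\<^sup>2 \<le> 1"
    using assms by (intro power_le_one) auto
  then have q: "?q \<ge> 2" by linarith
  then have "1 / ?q \<le> 1 / 2" by (intro divide_left_mono) auto
  then have "exp (- (1 / 2)) \<le> exp (- 1 / ?q)" by simp
  then have "exp (1/2) * exp (- (1 / 2)) \<le> exp (1/2) * exp (- 1 / ?q)" by (intro mult_left_mono) auto
  then have "1 \<le> exp (1/2) * exp (- 1 / ?q)" by (simp flip: exp_add)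
  then show ?thesis using q by (simp add: cutoff_def flat_def)
qed

lemma exp_half_le_2: "exp (1/2 :: real) \<le> 2"
proof -
  have "exp (1/2 :: real) ^ 2 = exp 1" by (simp flip: exp_of_nat_mult)
  also have "\<dots> \<le> 2 ^ 2" using exp_le by simp
  finally show ?thesis by (rule power2_le_imp_le) simp
qed

lemma abs_cutoff_le: "\<bar>cutoff z\<^sub>0 r z\<bar> \<le> 2"
proof -
  have "flat 0 x \<le> 1" for x by (simp add: flat_def)
  from mult_mono[OF exp_half_le_2 this, of "3 - (norm (z - z\<^sub>0) / r)\<^sup>2"] show ?thesis
    using flat_nonneg by (simp add: cutoff_def abs_mult)
qed

lemma cutoff_support: "r > 0 \<Longrightarrow> cutoff z\<^sub>0 r z \<noteq> 0 \<Longrightarrow> norm (z - z\<^sub>0) \<le> sqrt 3 * r"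
proof (rule ccontr)
  assume "r > 0" and nz: "cutoff z\<^sub>0 r z \<noteq> 0" and "\<not> norm (z - z\<^sub>0) \<le> sqrt 3 * r"
  then have "sqrt 3 \<le> norm (z - z\<^sub>0) / r" by (simp add: field_simps)
  then have "(sqrt 3)\<^sup>2 \<le> (norm (z - z\<^sub>0) / r)\<^sup>2" by (intro power_mono) auto
  then show False using nz by (simp add: cutoff_def flat_def)
qed

lemma norm_gradient_cutoff_le:
  assumes "r > 0"
  shows "norm (gradient (cutoff z\<^sub>0 r) z) \<le> 32 / r"
proof -
  define q where "q = (\<lambda>z. 3 - (norm (z - z\<^sub>0) / r)\<^sup>2)"
  define f where "f = flat 2 (q z)"
  define c where "c = 1 / r\<^sup>2"
  have q_eq: "q = (\<lambda>z. 3 - c * ((z - z\<^sub>0) \<bullet> (z - z\<^sub>0)))"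
    by (simp add: q_def c_def power_divide power2_norm_eq_inner)
  have "(q has_derivative (\<lambda>h. - (c * (2 * ((z - z\<^sub>0) \<bullet> h))))) (at z)"
    unfolding q_eq by (auto intro!: derivative_eq_intros simp: inner_commute)
  moreover have "(flat 0 has_derivative (\<lambda>h. f * h)) (at (q z))"
    using flat_has_derivative[of 0 "q z"] by (simp add: has_field_derivative_def f_def numeral_2_eq_2)
  ultimately have "((\<lambda>z. flat 0 (q z)) has_derivative (\<lambda>h. f * (- (c * (2 * ((z - z\<^sub>0) \<bullet> h)))))) (at z)"
    by (rule has_derivative_compose)
  then have "(cutoff z\<^sub>0 r has_derivative (\<lambda>h. exp (1/2) * (f * (- (c * (2 * ((z - z\<^sub>0) \<bullet> h))))))) (at z)"
    unfolding cutoff_def[abs_def] q_def by (rule has_derivative_mult_right)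
  moreover have "exp (1/2) * (f * (- (c * (2 * ((z - z\<^sub>0) \<bullet> h)))))
      = ((- exp (1/2) * f * 2 * c) *\<^sub>R (z - z\<^sub>0)) \<bullet> h" for h
    by simp
  ultimately have g: "gradient (cutoff z\<^sub>0 r) z = (- exp (1/2) * f * 2 * c) *\<^sub>R (z - z\<^sub>0)"
    by (intro gradient_eqI) (simp only:)
  have f: "0 \<le> f" "f \<le> 4"
    using flat_nonneg flat_le[of 2 _ 0] by (simp_all add: f_def)
  show ?thesis
  proof (cases "norm (z - z\<^sub>0) \<le> 2 * r")
    case True
    have "norm (gradient (cutoff z\<^sub>0 r) z) = (exp (1/2) * f) * (2 / r\<^sup>2 * norm (z - z\<^sub>0))"
      using f by (simp add: g c_def abs_mult)
    also have "\<dots> \<le> (2 * 4) * (2 / r\<^sup>2 * (2 * r))"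
      using f assms True exp_half_le_2 by (intro mult_mono) auto
    also have "\<dots> = 32 / r" using assms by (simp add: power2_eq_square)
    finally show ?thesis .
  next
    case False
    then have "2 \<le> norm (z - z\<^sub>0) / r" using assms by (simp add: field_simps)
    then have "2\<^sup>2 \<le> (norm (z - z\<^sub>0) / r)\<^sup>2" by (intro power_mono) auto
    then have "f = 0" by (simp add: f_def flat_def q_def)
    then show ?thesis using assms by (simp add: g)
  qed
qed

section \<open>Extension to one more dimension\<close>

text \<open>Compare \<open>u\<close> with its values on a ball \<open>B\<close> of radius \<open>r\<close> where it vanishes, at a distance comparable
  to \<open>r\<close>: for \<open>y\<close> in \<open>B\<close> the difference \<open>u x - u y\<close> is \<open>u x\<close>, and \<open>|x - y| \<le> 6 r\<close> if \<open>u x \<noteq> 0\<close>.\<close>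
lemma besov_poincare:
  fixes u :: "'a::euclidean_space \<Rightarrow> real"
  assumes u: "continuous_on UNIV u" and supp: "\<And>x. u x \<noteq> 0 \<Longrightarrow> x \<in> ball x0 (2 * r)"
    and p: "p > 0" "s > 0" "r > 0"
  shows "(\<integral>\<^sup>+x. ennreal (\<bar>u x\<bar> powr p) \<partial>lborel)
    \<le> ennreal (6 powr (real DIM('a) + s * p) / unit_ball_vol (real DIM('a)) * r powr (s * p))
      * besov_energy s p u"
proof -
  let ?n = "DIM('a)" and ?\<omega> = "unit_ball_vol (real DIM('a))"
  have [measurable]: "u \<in> borel_measurable borel"
    using u by (rule borel_measurable_continuous_onI)
  define e where "e = real ?n + s * p"
  have e: "e > 0" using p by (simp add: e_def add_pos_pos)
  obtain b :: 'a where b: "b \<in> Basis" using nonempty_Basis by blast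
  \<comment> \<open>Its points have distance between \<open>2 r\<close> and \<open>4 r\<close> from \<open>x0\<close>.\<close>
  define B where "B = cball (x0 + (3 * r) *\<^sub>R b) r"
  have [measurable]: "B \<in> sets borel" by (simp add: B_def)
  have far: "dist x0 y \<ge> 2 * r" "dist x0 y \<le> 4 * r" if "y \<in> B" for y
  proof -
    have d: "dist x0 (x0 + (3 * r) *\<^sub>R b) = 3 * r" using b p by (simp add: dist_norm)
    show "dist x0 y \<ge> 2 * r" "dist x0 y \<le> 4 * r"
      using that d dist_triangle[of x0 "x0 + (3 * r) *\<^sub>R b" y] dist_triangle[of x0 y "x0 + (3 * r) *\<^sub>R b"]
      by (auto simp: B_def dist_commute)
  qed
  define c where "c = 1 / (6 * r) powr e"
  have c: "c > 0" using p by (simp add: c_def)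
  let ?I = "\<integral>\<^sup>+x. ennreal (\<bar>u x\<bar> powr p) \<partial>lborel"
  have "ennreal (c * (?\<omega> * r ^ ?n)) * ?I = (\<integral>\<^sup>+y. indicator B y * (ennreal c * ?I) \<partial>lborel)"
  proof -
    have "(\<integral>\<^sup>+y. indicator B y * (ennreal c * ?I) \<partial>lborel) = emeasure lborel B * (ennreal c * ?I)"
      by (subst nn_integral_multc) simp_all
    also have "emeasure lborel B = ennreal (?\<omega> * r ^ ?n)"
      using p by (simp add: B_def emeasure_cball)
    also have "\<dots> * (ennreal c * ?I) = ennreal (c * (?\<omega> * r ^ ?n)) * ?I"
      using c p by (simp add: ennreal_mult' mult_ac)
    finally show ?thesis by simp
  qed
  also have "\<dots> = (\<integral>\<^sup>+y. (\<integral>\<^sup>+x. indicator B y * (ennreal c * ennreal (\<bar>u x\<bar> powr p)) \<partial>lborel) \<partial>lborel)"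
    by (simp add: nn_integral_cmult)
  also have "\<dots> \<le> besov_energy s p u"
    unfolding besov_energy_def e_def[symmetric]
  proof (intro nn_integral_mono)
    fix x y :: 'a
    show "indicator B y * (ennreal c * ennreal (\<bar>u x\<bar> powr p))
      \<le> ennreal (\<bar>u x - u y\<bar> powr p / norm (x - y) powr e)"
    proof (cases "y \<in> B \<and> u x \<noteq> 0")
      case True
      then have x: "dist x0 x < 2 * r" using supp by simp
      have "u y = 0" using far(1)[of y] supp[of y] True by force
      have "norm (x - y) > 0" using x far(1)[of y] True by auto
      moreover have "norm (x - y) \<le> 6 * r"
        using x far(2)[of y] True dist_triangle[of x y x0] by (simp add: dist_commute flip: dist_norm)
      ultimately have "c \<le> 1 / norm (x - y) powr e"
        unfolding c_def using e by (intro divide_left_mono powr_mono2 mult_pos_pos) auto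
      then have "c * \<bar>u x\<bar> powr p \<le> 1 / norm (x - y) powr e * \<bar>u x\<bar> powr p"
        by (intro mult_right_mono) auto
      then show ?thesis
        using True \<open>u y = 0\<close> c by (simp add: ennreal_leI flip: ennreal_mult)
    next
      case False
      then show ?thesis using p by (auto simp: indicator_def)
    qed
  qed
  finally have main: "ennreal (c * (?\<omega> * r ^ ?n)) * ?I \<le> besov_energy s p u" .
  have \<omega>: "?\<omega> > 0" "?\<omega> \<noteq> 0" using unit_ball_vol_pos[of "real ?n"] by linarith+
  have const: "6 powr e / ?\<omega> * r powr (s * p) * (c * (?\<omega> * r ^ ?n)) = 1"
    using p \<omega> by (simp add: c_def e_def powr_mult powr_add powr_realpow field_simps)
  have "?I = ennreal (6 powr e / ?\<omega> * r powr (s * p) * (c * (?\<omega> * r ^ ?n))) * ?I"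
    unfolding const by simp
  also have "\<dots> = ennreal (6 powr e / ?\<omega> * r powr (s * p)) * (ennreal (c * (?\<omega> * r ^ ?n)) * ?I)"
    using c \<omega> p by (subst ennreal_mult) (auto simp: mult.assoc)
  also have "\<dots> \<le> ennreal (6 powr e / ?\<omega> * r powr (s * p)) * besov_energy s p u"
    by (intro mult_left_mono main) auto
  finally show ?thesis by (simp only: e_def)
qed

text \<open>The first summand comes from the gradient of the average, the second one from the gradient of the
  cutoff: a weighted integral over heights up to \<open>2 r\<close> and the Poincare inequality, both without
  their powers of \<open>r\<close>.\<close>
definition extension_const :: "real \<Rightarrow> real \<Rightarrow> 'a::euclidean_space itself \<Rightarrow> real" where
  "extension_const s p T = 4 powr p * (tent_gradient_const p T
        * (2 powr (real DIM('a) + s * p + 1) / (real DIM('a) + s * p)))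
    + 64 powr p * (2 * 2 powr (p * (1 - s)) / (p * (1 - s)))
        * (6 powr (real DIM('a) + s * p) / unit_ball_vol (real DIM('a)))"

text \<open>In the term with the gradient of the cutoff, of size \<open>1 / r\<close>, the powers of \<open>r\<close> are \<open>- p\<close> from
  the gradient, \<open>a + 1\<close> from the integral of the weight and \<open>s p\<close> from the Poincare inequality.
  Their sum is 0, so the constant does not depend on \<open>r\<close>.\<close>
lemma extension_energy_le:
  fixes u :: "'a::euclidean_space \<Rightarrow> real"
  assumes u: "C_k 1 u" and supp: "\<And>x. u x \<noteq> 0 \<Longrightarrow> x \<in> ball x0 (2 * r)"
    and p: "p > 1" and s: "0 < s" "s < 1" and a: "a = p * (1 - s) - 1" and r: "r > 0"
  defines "v \<equiv> \<lambda>z. cutoff (x0, 0) r z * tent_average u z"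
  shows "(\<integral>\<^sup>+z\<in>ball (x0, 0) (2 * r). ennreal (norm (gradient v z) powr p) \<partial>weighted_measure a)
    \<le> ennreal (extension_const s p TYPE('a)) * besov_energy s p u"
proof -
  let ?n = "DIM('a)" and ?U = "tent_average u" and ?\<eta> = "cutoff (x0, 0) r"
  define e where "e = real ?n + s * p"
  define A where "A = tent_gradient_const p TYPE('a) * (2 powr (e + 1) / e)"
  define b where "b = p * (1 - s)"
  have b: "b > 0" using p s by (simp add: b_def)
  have e: "e > 0" using p s by (simp add: e_def add_pos_pos)
  have A0: "A \<ge> 0" using e by (simp add: A_def tent_gradient_const_def)
  have contu: "continuous_on UNIV u" using C_k_continuous_on[OF u] .
  have U: "C_k 1 ?U" by (rule C_k_tent_average[OF u])
  have [measurable]: "gradient ?U \<in> borel_measurable borel"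
    by (rule borel_measurable_continuous_onI[OF C_k_1_continuous_gradient[OF U]])
  have [measurable]: "?U \<in> borel_measurable borel"
    by (rule borel_measurable_continuous_onI[OF C_k_continuous_on[OF U]])
  have [measurable]: "u \<in> borel_measurable borel"
    by (rule borel_measurable_continuous_onI[OF contu])
  define F where "F z = ennreal (\<bar>?U z\<bar> powr p) * indicator {..2 * r} \<bar>snd z\<bar>" for z
  have [measurable]: "(snd :: 'a \<times> real \<Rightarrow> real) \<in> borel_measurable borel"
    by (intro borel_measurable_continuous_onI continuous_intros)
  have [measurable]: "F \<in> borel_measurable borel"
    unfolding F_def by measurable
  let ?E = "\<integral>\<^sup>+z. ennreal (norm (gradient ?U z) powr p) \<partial>weighted_measure a"
  let ?Iu = "\<integral>\<^sup>+x. ennreal (\<bar>u x\<bar> powr p) \<partial>lborel"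

  have pointwise: "norm (gradient v z) powr p
      \<le> 4 powr p * norm (gradient ?U z) powr p + (64 / r) powr p * \<bar>?U z\<bar> powr p" for z
  proof -
    have "gradient v z = ?\<eta> z *\<^sub>R gradient ?U z + ?U z *\<^sub>R gradient ?\<eta> z"
      unfolding v_def by (intro gradient_mult C_k_1_differentiable U C_k_cutoff)
    then have "norm (gradient v z) \<le> \<bar>?\<eta> z\<bar> * norm (gradient ?U z) + \<bar>?U z\<bar> * norm (gradient ?\<eta> z)"
      by (metis norm_triangle_ineq norm_scaleR)
    also have "\<dots> \<le> 2 * norm (gradient ?U z) + \<bar>?U z\<bar> * (32 / r)"
      using r by (intro add_mono mult_right_mono mult_left_mono abs_cutoff_le norm_gradient_cutoff_le) auto
    finally have "norm (gradient v z) powr p \<le> (2 * norm (gradient ?U z) + \<bar>?U z\<bar> * (32 / r)) powr p"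
      using p by (intro powr_mono2) auto
    also have "\<dots> \<le> 2 powr p * ((2 * norm (gradient ?U z)) powr p + (\<bar>?U z\<bar> * (32 / r)) powr p)"
      using p r by (intro powr_add_le) auto
    also have "\<dots> = (2 * 2) powr p * norm (gradient ?U z) powr p + (2 * (32 / r)) powr p * \<bar>?U z\<bar> powr p"
      using r by (simp only: powr_mult distrib_left mult_ac)
    finally show ?thesis by simp
  qed

  have F_le: "(\<integral>\<^sup>+z. F z \<partial>weighted_measure a) \<le> ennreal (2 * (2 * r) powr b / b) * ?Iu"
  proof -
    have "(\<integral>\<^sup>+z. F z \<partial>weighted_measure a) = (\<integral>\<^sup>+t. (\<integral>\<^sup>+x. ennreal (\<bar>t\<bar> powr a) * F (x, t) \<partial>lborel) \<partial>lborel)"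
      by (rule nn_integral_weighted_measure) measurable
    also have "\<dots> \<le> (\<integral>\<^sup>+t. (ennreal (\<bar>t\<bar> powr a) * indicator {..2 * r} \<bar>t\<bar>) * ?Iu \<partial>lborel)"
    proof (intro nn_integral_mono)
      fix t :: real
      have "(\<integral>\<^sup>+x. ennreal (\<bar>t\<bar> powr a) * F (x, t) \<partial>lborel)
          = (ennreal (\<bar>t\<bar> powr a) * indicator {..2 * r} \<bar>t\<bar>) * (\<integral>\<^sup>+x. ennreal (\<bar>?U (x, t)\<bar> powr p) \<partial>lborel)"
        unfolding F_def by (subst nn_integral_cmult[symmetric]) (auto intro!: nn_integral_cong simp: mult_ac)
      also have "\<dots> \<le> (ennreal (\<bar>t\<bar> powr a) * indicator {..2 * r} \<bar>t\<bar>) * ?Iu"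
        by (intro mult_left_mono nn_integral_tent_average_powr_le contu p) auto
      finally show "(\<integral>\<^sup>+x. ennreal (\<bar>t\<bar> powr a) * F (x, t) \<partial>lborel)
        \<le> (ennreal (\<bar>t\<bar> powr a) * indicator {..2 * r} \<bar>t\<bar>) * ?Iu" .
    qed
    also have "\<dots> = (\<integral>\<^sup>+t. ennreal (\<bar>t\<bar> powr a) * indicator {..2 * r} \<bar>t\<bar> \<partial>lborel) * ?Iu"
      by (intro nn_integral_multc) measurable
    also have "(\<integral>\<^sup>+t. ennreal (\<bar>t\<bar> powr a) * indicator {..2 * r} \<bar>t\<bar> \<partial>lborel)
        = ennreal (2 * (2 * r) powr (a + 1) / (a + 1))"
      using b r by (intro nn_integral_powr_abs_interval) (auto simp: a b_def)
    finally show ?thesis by (simp add: a b_def)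
  qed

  have "(\<integral>\<^sup>+z\<in>ball (x0, 0) (2 * r). ennreal (norm (gradient v z) powr p) \<partial>weighted_measure a)
      \<le> (\<integral>\<^sup>+z. ennreal (4 powr p) * ennreal (norm (gradient ?U z) powr p)
          + ennreal ((64 / r) powr p) * F z \<partial>weighted_measure a)"
  proof (intro nn_integral_mono)
    fix z :: "'a \<times> real"
    show "ennreal (norm (gradient v z) powr p) * indicator (ball (x0, 0) (2 * r)) z
      \<le> ennreal (4 powr p) * ennreal (norm (gradient ?U z) powr p) + ennreal ((64 / r) powr p) * F z"
    proof (cases "z \<in> ball (x0, 0) (2 * r)")
      case True
      have "\<bar>snd z\<bar> \<le> dist (x0, 0) z"
        using dist_snd_le[of "(x0, 0)" z] by (simp add: dist_real_def)
      then have "\<bar>snd z\<bar> \<le> 2 * r" using True by simp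
      then have F: "F z = ennreal (\<bar>?U z\<bar> powr p)" by (simp add: F_def)
      show ?thesis
        unfolding F using True ennreal_leI[OF pointwise[of z]]
        by (simp add: ennreal_mult)
    qed simp
  qed
  also have "\<dots> = ennreal (4 powr p) * ?E + ennreal ((64 / r) powr p) * (\<integral>\<^sup>+z. F z \<partial>weighted_measure a)"
  proof -
    have M: "f \<in> borel_measurable (weighted_measure a)" if "f \<in> borel_measurable borel" for f :: "'a \<times> real \<Rightarrow> ennreal"
      using that by (simp add: weighted_measure_def)
    let ?f = "\<lambda>z. ennreal (norm (gradient ?U z) powr p)"
    have "?f \<in> borel_measurable borel" "F \<in> borel_measurable borel"
      "(\<lambda>z. ennreal (4 powr p) * ?f z) \<in> borel_measurable borel"
      "(\<lambda>z. ennreal ((64 / r) powr p) * F z) \<in> borel_measurable borel"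
      by measurable
    note m = this[THEN M]
    show ?thesis
      by (simp only: nn_integral_add[OF m(3,4)] nn_integral_cmult[OF m(1)] nn_integral_cmult[OF m(2)])
  qed
  also have "\<dots> \<le> ennreal (4 powr p) * (ennreal A * besov_energy s p u)
      + ennreal ((64 / r) powr p) * (ennreal (2 * (2 * r) powr b / b)
        * (ennreal (6 powr e / unit_ball_vol (real ?n) * r powr (s * p)) * besov_energy s p u))"
  proof (intro add_mono mult_left_mono)
    show "?E \<le> ennreal A * besov_energy s p u"
      unfolding A_def e_def by (rule tent_average_energy_le[OF u p s(1) a])
    have "?Iu \<le> ennreal (6 powr e / unit_ball_vol (real ?n) * r powr (s * p)) * besov_energy s p u"
      unfolding e_def by (rule besov_poincare[OF contu supp _ s(1) r]) (use p in auto)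
    then show "(\<integral>\<^sup>+z. F z \<partial>weighted_measure a) \<le> ennreal (2 * (2 * r) powr b / b)
        * (ennreal (6 powr e / unit_ball_vol (real ?n) * r powr (s * p)) * besov_energy s p u)"
      by (intro order_trans[OF F_le] mult_left_mono) auto
  qed auto
  also have "\<dots> = (ennreal (4 powr p * A) + ennreal ((64 / r) powr p * (2 * (2 * r) powr b / b)
        * (6 powr e / unit_ball_vol (real ?n) * r powr (s * p)))) * besov_energy s p u"
  proof -
    have "ennreal (4 powr p * A) = ennreal (4 powr p) * ennreal A"
      using A0 by (intro ennreal_mult) auto
    moreover have "ennreal ((64 / r) powr p * (2 * (2 * r) powr b / b)
          * (6 powr e / unit_ball_vol (real ?n) * r powr (s * p)))
        = ennreal ((64 / r) powr p) * ennreal (2 * (2 * r) powr b / b)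
          * ennreal (6 powr e / unit_ball_vol (real ?n) * r powr (s * p))"
      using b by (subst ennreal_mult, simp, simp, subst ennreal_mult) auto
    ultimately show ?thesis by (simp only: distrib_right mult.assoc)
  qed
  also have "(64 / r) powr p * (2 * (2 * r) powr b / b) * (6 powr e / unit_ball_vol (real ?n) * r powr (s * p))
      = 64 powr p * (2 * 2 powr b / b) * (6 powr e / unit_ball_vol (real ?n))"
  proof -
    have "r powr b * r powr (s * p) = r powr p"
      by (simp add: b_def algebra_simps flip: powr_add)
    then have "r powr b * r powr (s * p) / r powr p = 1" using r by simp
    moreover have "(64 / r) powr p * (2 * (2 * r) powr b / b) * (6 powr e / unit_ball_vol (real ?n) * r powr (s * p))
        = (r powr b * r powr (s * p) / r powr p) * (64 powr p * (2 * 2 powr b / b) * (6 powr e / unit_ball_vol (real ?n)))"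
      using r by (simp add: powr_divide powr_mult mult_ac)
    ultimately show ?thesis by simp
  qed
  also have "ennreal (4 powr p * A) + ennreal (64 powr p * (2 * 2 powr b / b) * (6 powr e / unit_ball_vol (real ?n)))
      = ennreal (extension_const s p TYPE('a))"
  proof -
    let ?X = "64 powr p * (2 * 2 powr b / b) * (6 powr e / unit_ball_vol (real ?n))"
    have "0 \<le> 4 powr p * A" "0 \<le> ?X" using A0 b by auto
    from ennreal_plus[OF this] show ?thesis
      by (simp only: extension_const_def A_def e_def b_def)
  qed
  finally show ?thesis .
qed

text \<open>The cutoff confines the support to the closed ball of radius \<open>sqrt 3 * r\<close>, and on \<open>K \<times> {0}\<close> the
  average is \<open>u\<close> itself.\<close>
lemma extension_admissible:
  fixes u :: "'a::euclidean_space \<Rightarrow> real"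
  assumes u: "C_infinity u" "\<And>x. x \<in> K \<Longrightarrow> u x \<ge> 1" and K: "K \<subseteq> cball x0 r" and r: "r > 0"
  shows "(\<lambda>z. cutoff (x0, 0) r z * tent_average u z) \<in> admissible (K \<times> {0}) (ball (x0, 0) (2 * r))"
proof -
  let ?v = "\<lambda>z. cutoff (x0, 0) r z * tent_average u z"
  have "C_infinity ?v"
    using u(1) unfolding C_infinity_def by (auto intro!: C_k_mult C_k_cutoff C_k_tent_average)
  have sub: "closure {z. ?v z \<noteq> 0} \<subseteq> cball (x0, 0) (sqrt 3 * r)"
  proof (rule closure_minimal)
    show "{z. ?v z \<noteq> 0} \<subseteq> cball (x0, 0) (sqrt 3 * r)"
      using cutoff_support[OF r, of "(x0, 0)"]
      unfolding subset_eq mem_Collect_eq mem_cball dist_norm norm_minus_commute[of "(x0, 0)"] by auto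
  qed simp
  have "sqrt 3 < 2" by (rule real_sqrt_less_mono[of 3 4, simplified])
  then have "cball (x0, 0) (sqrt 3 * r) \<subseteq> ball (x0, 0 :: real) (2 * r)"
    using r by (intro cball_subset_ball_iff[THEN iffD2]) simp
  moreover have "compact (closure {z. ?v z \<noteq> 0})"
    using bounded_subset[OF bounded_cball sub] closure_subset
    unfolding compact_closure by (rule bounded_subset)
  moreover have "1 \<le> ?v z" if z_in: "z \<in> K \<times> {0}" for z
  proof -
    obtain x where z: "z = (x, 0)" "x \<in> K" using z_in by auto
    have "norm ((x, 0 :: real) - (x0, 0)) \<le> r"
      using z K by (auto simp: norm_Pair dist_norm norm_minus_commute)
    then have "1 * 1 \<le> cutoff (x0, 0) r z * u x"
      using z u(2) cutoff_ge_1[of z "(x0, 0)" r] r by (intro mult_mono) auto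
    then show ?thesis using z by simp
  qed
  ultimately show ?thesis
    using \<open>C_infinity ?v\<close> sub by (auto simp: admissible_def test_functions_def)
qed

section \<open>Comparison of the capacities\<close>

lemma ennreal_le_mult_of_divide_le:
  assumes "C > 0" "x / ennreal C \<le> y"
  shows "x \<le> ennreal C * y"
proof -
  have "x = x * ennreal C / ennreal C"
    using assms(1) by (intro mult_divide_eq_ennreal[symmetric]) auto
  also have "\<dots> = ennreal C * (x / ennreal C)"
    by (simp only: ennreal_times_divide mult.commute)
  also have "\<dots> \<le> ennreal C * y"
    by (intro mult_left_mono assms) simp
  finally show ?thesis .
qed

lemma trace_admissible:
  fixes v :: "'a::euclidean_space \<times> real \<Rightarrow> real"
  assumes "v \<in> admissible (K \<times> {0}) (ball (x0, 0) R)"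
  shows "(\<lambda>x. v (x, 0)) \<in> admissible K (ball x0 R)"
proof -
  let ?S = "closure {z. v z \<noteq> 0}"
  have v: "C_infinity v" "compact ?S" "?S \<subseteq> ball (x0, 0) R" "\<And>z. z \<in> K \<times> {0} \<Longrightarrow> 1 \<le> v z"
    using assms by (auto simp: admissible_def test_functions_def)
  have "C_k k (\<lambda>x. v (x, 0))" for k
  proof (rule C_k_compose[where u = v and G = "\<lambda>x. (x, 0)"])
    show "C_k k v" using v by (simp add: C_infinity_def)
    show "C_k k (\<lambda>x :: 'a. (x, 0 :: real) \<bullet> b)" for b
      using C_k_linear[OF bounded_linear_inner_left[of "fst b"], of k] by (simp add: inner_prod_def)
  qed
  then have "C_infinity (\<lambda>x. v (x, 0))" by (simp add: C_infinity_def)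
  moreover have sub: "closure {x. v (x, 0) \<noteq> 0} \<subseteq> fst ` ?S \<and> closure {x. v (x, 0) \<noteq> 0} \<subseteq> ball x0 R"
  proof -
    have cl: "closed ((\<lambda>x. (x, 0 :: real)) -` ?S)"
      by (intro continuous_closed_vimage) (auto intro!: continuous_intros)
    have "closure {x. v (x, 0) \<noteq> 0} \<subseteq> (\<lambda>x. (x, 0)) -` ?S"
      using closure_subset[of "{z. v z \<noteq> 0}"] by (intro closure_minimal cl) auto
    then show ?thesis
      using v(3) by (force simp: dist_Pair_Pair)
  qed
  moreover have "compact (closure {x. v (x, 0) \<noteq> 0})"
  proof -
    have "compact (fst ` ?S)" using v(2) by (intro compact_continuous_image continuous_intros)
    from compact_imp_bounded[OF this] have "bounded {x. v (x, 0) \<noteq> 0}"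
      using sub closure_subset[of "{x. v (x, 0) \<noteq> 0}"] by (blast intro: bounded_subset)
    then show ?thesis by (simp only: compact_closure)
  qed
  ultimately show ?thesis using v(4) by (auto simp: admissible_def test_functions_def)
qed

text \<open>The integral over the whole space in the trace inequality may be restricted to the ball, because
  the gradient of a test function vanishes outside its support.\<close>
lemma besov_cap_compact_le:
  assumes p: "p > 1" and s: "0 < s" and a: "a = p * (1 - s) - 1"
  shows "\<exists>C>0. \<forall>(K :: 'a::euclidean_space set) x0 R.
    besov_cap_compact s p K (ball x0 R) \<le> ennreal C * weighted_cap_compact p a (K \<times> {0}) (ball (x0, 0) R)"
proof -
  obtain m0 :: nat where "1 / s \<le> real m0" using real_arch_simple by blast
  then have "1 \<le> real m0 * s" using s by (simp add: field_simps)
  \<comment> \<open>The trace estimate needs \<open>m s \<ge> 1\<close>, and \<open>m \<ge> 2\<close> for the end point \<open>\<theta> = 0\<close>.\<close>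
  moreover define m where "m = max 2 m0"
  ultimately have m: "m \<ge> 2" "real m * s \<ge> 1"
    using s by (auto intro: order_trans[OF _ mult_right_mono])
  define C where "C = 2 powr p * 2 * ((2 * real m) powr p * (real DIM('a) * unit_ball_vol (real DIM('a))))"
  have C: "C > 0" using m by (simp add: C_def)
  have "besov_cap_compact s p K (ball x0 R) \<le> ennreal C * weighted_cap_compact p a (K \<times> {0}) (ball (x0, 0) R)"
    for K :: "'a set" and x0 R
  proof -
    have "besov_cap_compact s p K (ball x0 R) / ennreal C
        \<le> (\<integral>\<^sup>+z\<in>ball (x0, 0) R. ennreal (norm (gradient v z) powr p) \<partial>weighted_measure a)"
      if v: "v \<in> admissible (K \<times> {0}) (ball (x0, 0) R)" for v
    proof (rule divide_le_posI_ennreal)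
      have v1: "C_k 1 v"
        using v by (auto simp only: admissible_def test_functions_def C_infinity_def mem_Collect_eq)
      have out: "gradient v z = 0" if "z \<notin> ball (x0, 0) R" for z
        using v that by (intro gradient_eq_0_outside_support) (auto simp: admissible_def test_functions_def)
      have "besov_cap_compact s p K (ball x0 R) \<le> besov_energy s p (\<lambda>x. v (x, 0))"
        unfolding besov_cap_compact_def by (intro INF_lower trace_admissible v)
      also have "\<dots> \<le> ennreal (2 powr p * 2) * cone_energy s p v"
        using p by (intro besov_energy_le_cone_energy C_k_continuous_on[OF v1]) auto
      also have "\<dots> \<le> ennreal (2 powr p * 2) * (ennreal ((2 * real m) powr p * (real DIM('a) * unit_ball_vol (real DIM('a))))
          * (\<integral>\<^sup>+z. ennreal (norm (gradient v z) powr p) \<partial>weighted_measure a))"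
        by (intro mult_left_mono cone_energy_le_weighted v1 p m a) auto
      also have "\<dots> = ennreal C * (\<integral>\<^sup>+z. ennreal (norm (gradient v z) powr p) \<partial>weighted_measure a)"
        by (simp add: C_def ennreal_mult mult.assoc)
      also have "(\<integral>\<^sup>+z. ennreal (norm (gradient v z) powr p) \<partial>weighted_measure a)
          = (\<integral>\<^sup>+z\<in>ball (x0, 0) R. ennreal (norm (gradient v z) powr p) \<partial>weighted_measure a)"
        using p by (intro nn_integral_cong) (auto simp: indicator_def out)
      finally show "besov_cap_compact s p K (ball x0 R)
          \<le> ennreal C * (\<integral>\<^sup>+z\<in>ball (x0, 0) R. ennreal (norm (gradient v z) powr p) \<partial>weighted_measure a)" .
    qed (use C in simp)
    then have "besov_cap_compact s p K (ball x0 R) / ennreal C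
        \<le> weighted_cap_compact p a (K \<times> {0}) (ball (x0, 0) R)"
      unfolding weighted_cap_compact_def by (intro INF_greatest)
    with C show ?thesis by (rule ennreal_le_mult_of_divide_le)
  qed
  with C show ?thesis by blast
qed

lemma weighted_cap_compact_le:
  assumes p: "p > 1" and s: "0 < s" "s < 1" and a: "a = p * (1 - s) - 1"
  shows "\<exists>C>0. \<forall>(K :: 'a::euclidean_space set) x0 r. r > 0 \<longrightarrow> K \<subseteq> cball x0 r \<longrightarrow>
    weighted_cap_compact p a (K \<times> {0}) (ball (x0, 0) (2 * r)) \<le> ennreal C * besov_cap_compact s p K (ball x0 (2 * r))"
proof -
  define C where "C = extension_const s p TYPE('a)"
  have C: "C > 0"
    using p s unfolding C_def extension_const_def tent_gradient_const_def
    by (intro add_nonneg_pos) (auto intro!: mult_nonneg_nonneg mult_pos_pos divide_pos_pos divide_nonneg_nonneg)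
  have "weighted_cap_compact p a (K \<times> {0}) (ball (x0, 0) (2 * r)) \<le> ennreal C * besov_cap_compact s p K (ball x0 (2 * r))"
    if r: "r > 0" and K: "K \<subseteq> cball x0 r" for K :: "'a set" and x0 r
  proof -
    let ?w = "weighted_cap_compact p a (K \<times> {0}) (ball (x0, 0) (2 * r))"
    have "?w / ennreal C \<le> besov_energy s p u" if u: "u \<in> admissible K (ball x0 (2 * r))" for u
    proof (rule divide_le_posI_ennreal)
      have inf: "C_infinity u" and ge: "\<And>x. x \<in> K \<Longrightarrow> u x \<ge> 1"
        and supp: "\<And>x. u x \<noteq> 0 \<Longrightarrow> x \<in> ball x0 (2 * r)"
        using u closure_subset[of "{x. u x \<noteq> 0}"] by (auto simp: admissible_def test_functions_def)
      have u1: "C_k 1 u" using inf unfolding C_infinity_def by blast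
      have "?w \<le> (\<integral>\<^sup>+z\<in>ball (x0, 0) (2 * r).
          ennreal (norm (gradient (\<lambda>z. cutoff (x0, 0) r z * tent_average u z) z) powr p) \<partial>weighted_measure a)"
        unfolding weighted_cap_compact_def by (intro INF_lower extension_admissible inf ge K r)
      also have "\<dots> \<le> ennreal C * besov_energy s p u"
        unfolding C_def by (intro extension_energy_le u1 supp p s a r)
      finally show "?w \<le> ennreal C * besov_energy s p u" .
    qed (use C in simp)
    then have "?w / ennreal C \<le> besov_cap_compact s p K (ball x0 (2 * r))"
      unfolding besov_cap_compact_def by (intro INF_greatest)
    with C show ?thesis by (rule ennreal_le_mult_of_divide_le)
  qed
  with C show ?thesis by blast
qed

theorem lemma1p3:
  fixes p s a :: real
  assumes "CARD('n::finite) \<ge> 2"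
    and "p > 1"
    and "0 < s" and "s < 1"
    and "a = p * (1 - s) - 1"
  shows "\<exists>C::real. C > 0 \<and>
    (\<forall>(x0 :: real ^ 'n) (r::real) (E :: (real ^ 'n) set).
       r > 0 \<longrightarrow> E \<in> sets borel \<longrightarrow> E \<subseteq> closure (ball x0 r) \<longrightarrow>
         besov_cap s p E (ball x0 (2 * r)) / ennreal C
           \<le> weighted_cap p a (E \<times> {0}) (ball (x0, 0) (2 * r)) \<and>
         weighted_cap p a (E \<times> {0}) (ball (x0, 0) (2 * r))
           \<le> ennreal C * besov_cap s p E (ball x0 (2 * r)))"
proof -
  obtain C1 where C1: "C1 > 0" and trace: "\<And>(K :: (real ^ 'n) set) x0 R.
      besov_cap_compact s p K (ball x0 R) \<le> ennreal C1 * weighted_cap_compact p a (K \<times> {0}) (ball (x0, 0) R)"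
    using besov_cap_compact_le[OF assms(2,3,5)] by blast
  obtain C2 where C2: "C2 > 0" and extension: "\<And>(K :: (real ^ 'n) set) x0 r. r > 0 \<Longrightarrow> K \<subseteq> cball x0 r \<Longrightarrow>
      weighted_cap_compact p a (K \<times> {0}) (ball (x0, 0) (2 * r)) \<le> ennreal C2 * besov_cap_compact s p K (ball x0 (2 * r))"
    using weighted_cap_compact_le[OF assms(2-5)] by blast
  define C where "C = max C1 C2"
  have C: "C > 0" "ennreal C1 \<le> ennreal C" "ennreal C2 \<le> ennreal C"
    using C1 by (auto simp: C_def intro!: ennreal_leI)
  have "besov_cap s p E (ball x0 (2 * r)) / ennreal C \<le> weighted_cap p a (E \<times> {0}) (ball (x0, 0) (2 * r))"
    for x0 :: "real ^ 'n" and r E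
  proof (rule divide_le_posI_ennreal)
    show "besov_cap s p E (ball x0 (2 * r)) \<le> ennreal C * weighted_cap p a (E \<times> {0}) (ball (x0, 0) (2 * r))"
      unfolding besov_cap_def
    proof (rule SUP_least)
      fix K assume "K \<in> {K. compact K \<and> K \<subseteq> E}"
      then have "weighted_cap_compact p a (K \<times> {0}) (ball (x0, 0) (2 * r))
          \<le> weighted_cap p a (E \<times> {0}) (ball (x0, 0) (2 * r))"
        unfolding weighted_cap_def by (intro SUP_upper) (auto intro: compact_Times)
      with C(2) have "ennreal C1 * weighted_cap_compact p a (K \<times> {0}) (ball (x0, 0) (2 * r))
          \<le> ennreal C * weighted_cap p a (E \<times> {0}) (ball (x0, 0) (2 * r))"
        by (intro mult_mono) auto
      with trace show "besov_cap_compact s p K (ball x0 (2 * r))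
          \<le> ennreal C * weighted_cap p a (E \<times> {0}) (ball (x0, 0) (2 * r))"
        by (rule order_trans)
    qed
  qed (use C in simp)
  moreover have "weighted_cap p a (E \<times> {0}) (ball (x0, 0) (2 * r)) \<le> ennreal C * besov_cap s p E (ball x0 (2 * r))"
    if r: "r > 0" and E: "E \<subseteq> closure (ball x0 r)" for x0 :: "real ^ 'n" and r E
    unfolding weighted_cap_def
  proof (rule SUP_least)
    fix K' :: "((real ^ 'n) \<times> real) set" assume K': "K' \<in> {K. compact K \<and> K \<subseteq> E \<times> {0}}"
    define K where "K = fst ` K'"
    have "compact K" unfolding K_def using K' by (intro compact_continuous_image continuous_intros) auto
    have "K \<subseteq> E" using K' by (auto simp: K_def)
    have "K' = K \<times> {0}" using K' by (force simp: K_def)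
    have "K \<subseteq> cball x0 r" using \<open>K \<subseteq> E\<close> E r by simp
    then have "weighted_cap_compact p a K' (ball (x0, 0) (2 * r)) \<le> ennreal C2 * besov_cap_compact s p K (ball x0 (2 * r))"
      unfolding \<open>K' = K \<times> {0}\<close> by (rule extension[OF r])
    also have "\<dots> \<le> ennreal C * besov_cap s p E (ball x0 (2 * r))"
      using C(3) \<open>compact K\<close> \<open>K \<subseteq> E\<close> unfolding besov_cap_def
      by (intro mult_mono SUP_upper) auto
    finally show "weighted_cap_compact p a K' (ball (x0, 0) (2 * r)) \<le> ennreal C * besov_cap s p E (ball x0 (2 * r))" .
  qed
  ultimately show ?thesis using C(1) by blast
qed

end
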